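(* Let $A\in\mathbb{R}\setminus\{0\}$ and $B,a_0,b_0\in\mathbb{R}$ with $a_0+b_0=B$, and put $a(\epsilon)=a_0+\frac{A}{\epsilon}$, $b(\epsilon)=b_0-\frac{A}{\epsilon}$ for $\epsilon\in(0,1]$; assume $b(\epsilon)\ne0$ for all $\epsilon\in(0,1]$. Let $\psi\in L^2(\mathbb{R})$ be nonzero and admissible for $\widetilde\rho_\epsilon^{a(\epsilon),b(\epsilon)}$ for every $\epsilon\in(0,1]$. Then for any $f,g\in L^2(\mathbb{R},dx)$, $$\lim_{\epsilon\to0^+}\int_{\mathbb{R}^2}\langle f|\psi_\epsilon^{a(\epsilon),b(\epsilon)}(q,p)\rangle\langle\psi_\epsilon^{a(\epsilon),b(\epsilon)}(q,p)|g\rangle\,\frac{e^{\epsilon q}-1}{\epsilon q}\,dq\,dp=\int_{\mathbb{R}^2}\langle f|\psi^{\eta^{A,B}}_{\sigma_H(q,p)}\rangle\langle\psi^{\eta^{A,B}}_{\sigma_H(q,p)}|g\rangle\,dq\,dp.$$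
   Context: Heisenberg group $H$: the set $\mathbb{R}\times\mathbb{R}^2$ with product $(x_1,(y_1,z_1))(x_2,(y_2,z_2))=(x_1+x_2,\,(y_1+y_2+x_1z_2,\ z_1+z_2))$; its representation $\eta^{A,B}$ on $L^2(\mathbb{R})$ is $(\eta^{A,B}(c,(v_1,v_2))f)(x)=e^{i[A(v_1+xv_2)+Bv_2]}f(c+x)$. Its coherent states are $|\psi^{\eta^{A,B}}_{\sigma_H(q,p)}\rangle=\eta^{A,B}\big(q,(\tfrac{qp}{2},p)\big)\psi$. Extended affine group $EA$: the set $\mathbb{R}^+\times\mathbb{R}\times\mathbb{R}$ with product $(\alpha,\beta,\gamma)(x,y,z)=(\alpha x,\alpha y+\beta,\gamma+z)$; for $\epsilon\in(0,1]$, $a\in\mathbb{R}$, $b\in\mathbb{R}\setminus\{0\}$ its representation $\rho_\epsilon^{a,b}$ on $L^2(\mathbb{R})$ is $(\rho_\epsilon^{a,b}(\alpha,\beta,\gamma)f)(x)=e^{ia\gamma}e^{ib\beta e^{-\epsilon x}}f\big(x-\tfrac{\log\alpha}{\epsilon}\big)$. With $P_\epsilon(x,(y,z))=\big(e^{-\epsilon x},\ z\tfrac{e^{-\epsilon x}-1}{-\epsilon x},\ z+\epsilon(y-\tfrac{xz}{2})\big)$ (fraction $=1$ at $x=0$), put $\widetilde\rho_\epsilon^{a,b}=\rho_\epsilon^{a,b}\circ P_\epsilon$ and $|\psi_\epsilon^{a,b}(q,p)\rangle=\widetilde\rho_\epsilon^{a,b}\big(q,(\tfrac{qp}{2},p)\big)\psi$.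 The function $\frac{e^{\epsilon q}-1}{\epsilon q}$ is read as $1$ at $q=0$. $\psi$ is admissible for $\widetilde\rho_\epsilon^{a,b}$ if $\int_{\mathbb{R}^2}|\langle\psi|\psi_\epsilon^{a,b}(q,p)\rangle|^2\,\frac{e^{\epsilon q}-1}{\epsilon q}\,dq\,dp<\infty$. Inner products are linear in the second argument. *)

theory Defs
  imports "HOL-Analysis.Analysis"
begin

text \<open>Elements of \<open>L\<^sup>2(\<real>)\<close> are handled through representatives; functions agreeing almost
  everywhere have the same inner products with everything, so nothing below depends on the choice.\<close>

definition L2 :: "(real \<Rightarrow> complex) set" where
  "L2 = {f. f \<in> borel_measurable lebesgue \<and> integrable lebesgue (\<lambda>x. (cmod (f x))\<^sup>2)}"

definition inner_L2 :: "(real \<Rightarrow> complex) \<Rightarrow> (real \<Rightarrow> complex) \<Rightarrow> complex" where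
  "inner_L2 f g = (LINT x|lebesgue. cnj (f x) * g x)"

type_synonym heisenberg = "real \<times> real \<times> real"

fun heis_mult :: "heisenberg \<Rightarrow> heisenberg \<Rightarrow> heisenberg" where
  "heis_mult (x1, y1, z1) (x2, y2, z2) = (x1 + x2, y1 + y2 + x1 * z2, z1 + z2)"

fun eta :: "real \<Rightarrow> real \<Rightarrow> heisenberg \<Rightarrow> (real \<Rightarrow> complex) \<Rightarrow> real \<Rightarrow> complex" where
  "eta A B (c, v1, v2) f x = cis (A * (v1 + x * v2) + B * v2) * f (c + x)"

lemma eta_mult: "eta A B (heis_mult g h) f = eta A B g (eta A B h f)"
  by (cases g; cases h) (auto simp: fun_eq_iff cis_mult algebra_simps)

definition sigma_H :: "real \<Rightarrow> real \<Rightarrow> heisenberg" where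
  "sigma_H q p = (q, q * p / 2, p)"

definition heis_coherent ::
    "real \<Rightarrow> real \<Rightarrow> (real \<Rightarrow> complex) \<Rightarrow> real \<Rightarrow> real \<Rightarrow> real \<Rightarrow> complex" where
  "heis_coherent A B \<psi> q p = eta A B (sigma_H q p) \<psi>"

text \<open>The extended affine group consists of the triples whose first component is positive.\<close>

type_synonym ext_affine = "real \<times> real \<times> real"

fun ea_mult :: "ext_affine \<Rightarrow> ext_affine \<Rightarrow> ext_affine" where
  "ea_mult (\<alpha>, \<beta>, \<gamma>) (x, y, z) = (\<alpha> * x, \<alpha> * y + \<beta>, \<gamma> + z)"

fun rho :: "real \<Rightarrow> real \<Rightarrow> real \<Rightarrow> ext_affine \<Rightarrow> (real \<Rightarrow> complex) \<Rightarrow> real \<Rightarrow> complex" where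
  "rho \<epsilon> a b (\<alpha>, \<beta>, \<gamma>) f x =
     cis (a * \<gamma>) * cis (b * \<beta> * exp (- \<epsilon> * x)) * f (x - ln \<alpha> / \<epsilon>)"

lemma rho_mult:
  assumes "\<epsilon> \<noteq> 0" "fst g > 0" "fst h > 0"
  shows "rho \<epsilon> a b (ea_mult g h) f = rho \<epsilon> a b g (rho \<epsilon> a b h f)"
proof
  fix t
  obtain \<alpha> \<beta> \<gamma> x y z where gh: "g = (\<alpha>, \<beta>, \<gamma>)" "h = (x, y, z)"
    by (cases g; cases h)
  have pos: "\<alpha> > 0" "x > 0"
    using assms gh by auto
  have "exp (- \<epsilon> * (t - ln \<alpha> / \<epsilon>)) = exp (- \<epsilon> * t + ln \<alpha>)"
    using assms(1) by (simp add: right_diff_distrib)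
  then have e: "exp (- \<epsilon> * (t - ln \<alpha> / \<epsilon>)) = \<alpha> * exp (- \<epsilon> * t)"
    using pos by (simp only: exp_add exp_ln mult.commute)
  have l: "t - ln (\<alpha> * x) / \<epsilon> = t - ln \<alpha> / \<epsilon> - ln x / \<epsilon>"
    using pos by (simp add: ln_mult add_divide_distrib)
  show "rho \<epsilon> a b (ea_mult g h) f t = rho \<epsilon> a b g (rho \<epsilon> a b h f) t"
    unfolding gh ea_mult.simps rho.simps e l mult.assoc[symmetric] cis_mult
    by (simp add: algebra_simps)
qed

fun P_map :: "real \<Rightarrow> heisenberg \<Rightarrow> ext_affine" where
  "P_map \<epsilon> (x, y, z) =
     (exp (- \<epsilon> * x),
      z * (if x = 0 then 1 else (exp (- \<epsilon> * x) - 1) / (- \<epsilon> * x)),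
      z + \<epsilon> * (y - x * z / 2))"

definition rho_tilde ::
    "real \<Rightarrow> real \<Rightarrow> real \<Rightarrow> heisenberg \<Rightarrow> (real \<Rightarrow> complex) \<Rightarrow> real \<Rightarrow> complex" where
  "rho_tilde \<epsilon> a b = rho \<epsilon> a b \<circ> P_map \<epsilon>"

definition ea_coherent ::
    "real \<Rightarrow> real \<Rightarrow> real \<Rightarrow> (real \<Rightarrow> complex) \<Rightarrow> real \<Rightarrow> real \<Rightarrow> real \<Rightarrow> complex" where
  "ea_coherent \<epsilon> a b \<psi> q p = rho_tilde \<epsilon> a b (q, q * p / 2, p) \<psi>"

definition weight :: "real \<Rightarrow> real \<Rightarrow> real" where
  "weight \<epsilon> q = (if q = 0 then 1 else (exp (\<epsilon> * q) - 1) / (\<epsilon> * q))"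

definition admissible :: "real \<Rightarrow> real \<Rightarrow> real \<Rightarrow> (real \<Rightarrow> complex) \<Rightarrow> bool" where
  "admissible \<epsilon> a b \<psi> \<longleftrightarrow>
     (\<integral>\<^sup>+ (q, p). ennreal ((cmod (inner_L2 \<psi> (ea_coherent \<epsilon> a b \<psi> q p)))\<^sup>2 * weight \<epsilon> q)
        \<partial>(lebesgue :: (real \<times> real) measure)) < \<infinity>"

definition ea_integrand ::
    "real \<Rightarrow> real \<Rightarrow> real \<Rightarrow> (real \<Rightarrow> complex) \<Rightarrow> (real \<Rightarrow> complex) \<Rightarrow> (real \<Rightarrow> complex) \<Rightarrow>
     real \<times> real \<Rightarrow> complex" where
  "ea_integrand \<epsilon> a b \<psi> f g = (\<lambda>(q, p).
     inner_L2 f (ea_coherent \<epsilon> a b \<psi> q p) * inner_L2 (ea_coherent \<epsilon> a b \<psi> q p) g *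
     complex_of_real (weight \<epsilon> q))"

definition heis_integrand ::
    "real \<Rightarrow> real \<Rightarrow> (real \<Rightarrow> complex) \<Rightarrow> (real \<Rightarrow> complex) \<Rightarrow> (real \<Rightarrow> complex) \<Rightarrow>
     real \<times> real \<Rightarrow> complex" where
  "heis_integrand A B \<psi> f g = (\<lambda>(q, p).
     inner_L2 f (heis_coherent A B \<psi> q p) * inner_L2 (heis_coherent A B \<psi> q p) g)"

end

theory Submission
  imports Defs "HOL-Probability.Probability" "HOL-Real_Asymp.Real_Asymp"
begin

text \<open>For fixed \<open>q\<close>, the overlap \<open>\<langle>f|\<psi>\<^sub>\<epsilon>(q,p)\<rangle>\<close> is, up to a phase, the Fourier transform in \<open>p\<close> of
  \<open>x \<mapsto> cnj (f x) \<psi>(x + q)\<close> pushed forward along \<open>x \<mapsto> b w(-q) e\<^sup>-\<^sup>\<epsilon>\<^sup>x\<close>, where \<open>w\<close> is the weight.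
  Plancherel's theorem in \<open>p\<close>, the identity \<open>w(q) = e\<^sup>\<epsilon>\<^sup>q w(-q)\<close> and Tonelli's theorem show that the
  squared overlaps integrate to \<open>2\<pi> / (\<epsilon>\<bar>b\<bar>) \<cdot> \<parallel>f\<parallel>\<^sup>2 \<cdot> \<integral>\<bar>\<psi>(y)\<bar>\<^sup>2 e\<^sup>\<epsilon>\<^sup>y dy\<close>, and polarization turns this into
  the inner product of \<open>f\<close> and \<open>g\<close>. The Heisenberg case is the same with the linear map \<open>x \<mapsto> A x\<close> and
  constant \<open>2\<pi> / \<bar>A\<bar> \<cdot> \<parallel>\<psi>\<parallel>\<^sup>2\<close>. Admissibility at \<open>\<epsilon> = 1\<close> gives \<open>\<integral>\<bar>\<psi>(y)\<bar>\<^sup>2 e\<^sup>y dy < \<infinity>\<close>, so dominated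
  convergence and \<open>\<epsilon>\<bar>b(\<epsilon>)\<bar> \<longlonglongrightarrow> \<bar>A\<bar>\<close> give the limit.\<close>

section \<open>Plancherel's theorem on the real line\<close>

text \<open>The transform is unnormalized and has a positive exponent, so Plancherel's identity
  carries the factor \<open>2 * pi\<close>.\<close>

definition fourier :: "(real \<Rightarrow> complex) \<Rightarrow> real \<Rightarrow> complex" where
  "fourier F p = (LBINT u. F u * cis (p * u))"

lemma integral_norm_le_integral:
  fixes f :: "'a \<Rightarrow> 'b::{banach, second_countable_topology}"
  assumes "integrable M g" and "\<And>x. norm (f x) \<le> g x"
  shows "norm (integral\<^sup>L M f) \<le> integral\<^sup>L M g"
  using assms by (intro order.trans[OF integral_norm_bound integral_mono'])
    (auto intro: order.trans[OF norm_ge_zero])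

lemma measurable_cis [measurable]: "cis \<in> borel_measurable borel"
  by (intro borel_measurable_continuous_onI continuous_intros)

lemma measurable_cnj [measurable]: "cnj \<in> borel_measurable borel"
  by (intro borel_measurable_continuous_onI continuous_intros)

lemma measurable_fourier [measurable]:
  assumes [measurable]: "F \<in> borel_measurable borel"
  shows "fourier F \<in> borel_measurable borel"
  unfolding fourier_def by measurable

lemma norm_fourier_le:
  "norm (fourier F p) \<le> (LBINT u. norm (F u))"
  unfolding fourier_def
  by (rule order.trans[OF integral_norm_bound]) (simp add: norm_mult)

lemma integrable_mult_cis:
  fixes F :: "'a \<Rightarrow> complex"
  assumes "integrable M F" and [measurable]: "h \<in> borel_measurable M"
  shows "integrable M (\<lambda>u. F u * cis (h u))"
  by (rule Bochner_Integration.integrable_bound[OF assms(1)])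
     (use assms(1) in \<open>auto simp: norm_mult\<close>)

section \<open>Gaussian regularization of the Fourier integral\<close>

lemma integral_std_normal_density_cis:
  "(LBINT t. complex_of_real (std_normal_density t) * cis (x * t)) = complex_of_real (exp (- x\<^sup>2 / 2))"
proof -
  have "char std_normal_distribution x = (LBINT t. std_normal_density t *\<^sub>R cis (x * t))"
    unfolding char_def cis_conv_exp
    by (subst integral_density) (auto simp: normal_density_nonneg)
  then show ?thesis
    by (simp add: char_std_normal_distribution scaleR_conv_of_real)
qed

lemma integrable_gaussian:
  fixes n :: real
  assumes "n > 0"
  shows "integrable lborel (\<lambda>p. exp (- (p / n)\<^sup>2 / 2))"
proof -
  have "(\<lambda>p. exp (- (p / n)\<^sup>2 / 2)) = (\<lambda>p. sqrt (2 * pi) * n * normal_density 0 n p)"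
    using assms by (simp add: fun_eq_iff normal_density_def real_sqrt_mult power_divide)
  then show ?thesis
    using assms by simp
qed

text \<open>Fubini moves the transform from \<open>c\<close> to the Gaussian, whose transform is
  again Gaussian. As \<open>n\<close> grows the right side samples \<open>c\<close> ever closer to
  0: a substitute for Fourier inversion at 0 when \<open>fourier c\<close> may fail to be
  integrable.\<close>

lemma fourier_gaussian_mean:
  fixes c :: "real \<Rightarrow> complex"
  assumes c: "integrable lborel c" and n: "n > 0"
  shows "(LBINT p. fourier c p * complex_of_real (exp (- (p / n)\<^sup>2 / 2))) =
    2 * pi * (LBINT t. c (t / n) * complex_of_real (std_normal_density t))"
proof -
  let ?D = "\<lambda>t. complex_of_real (std_normal_density t)"
  have [measurable]: "c \<in> borel_measurable borel"
    using c by auto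
  have D: "integrable lborel ?D"
    by (intro integrable_of_real) simp
  have Dn: "integrable lborel (\<lambda>p. ?D (p / n))"
    using lborel_integrable_real_affine[OF D, of "1 / n" 0] n by simp
  have E: "complex_of_real (exp (- (p / n)\<^sup>2 / 2)) = complex_of_real (sqrt (2 * pi)) * ?D (p / n)" for p
    by (simp only: of_real_mult[symmetric]) (simp add: std_normal_density_def)
  have "integrable (lborel \<Otimes>\<^sub>M lborel) (\<lambda>(u, p). c u * ?D (p / n))"
    by (rule lborel_pair.Fubini_integrable)
       (use c Dn in \<open>auto simp: norm_mult integrable_mult_left\<close>)
  then have I: "integrable (lborel \<Otimes>\<^sub>M lborel) (\<lambda>(u, p). c u * ?D (p / n) * cis (p * u))"
    using integrable_mult_cis[of "lborel \<Otimes>\<^sub>M lborel" "\<lambda>(u, p). c u * ?D (p / n)" "\<lambda>(u, p). p * u"]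
    by (simp add: case_prod_beta')
  have "(LBINT p. fourier c p * ?D (p / n)) = (LBINT p. LBINT u. c u * ?D (p / n) * cis (p * u))"
    unfolding fourier_def by (subst integral_mult_left_zero[symmetric]) (simp add: ac_simps)
  also have "\<dots> = (LBINT u. LBINT p. c u * ?D (p / n) * cis (p * u))"
    using lborel_pair.Fubini_integral[OF I] by simp
  \<comment> \<open>The substitution \<open>p = n * t\<close> turns the inner integral into the
    characteristic function of the standard normal law at \<open>n * u\<close>.\<close>
  also have "\<dots> = (LBINT u. c u * (n * complex_of_real (exp (- (n * u)\<^sup>2 / 2))))"
  proof (rule Bochner_Integration.integral_cong[OF refl])
    fix u
    have "(LBINT p. c u * ?D (p / n) * cis (p * u)) = c u * (LBINT p. ?D (p / n) * cis (p * u))"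
      by (subst integral_mult_right_zero[symmetric]) (simp add: ac_simps)
    also have "(LBINT p. ?D (p / n) * cis (p * u)) = n * (LBINT t. ?D t * cis (n * u * t))"
      using n by (subst lborel_integral_real_affine[where c = n and t = 0])
        (auto simp: ac_simps scaleR_conv_of_real)
    finally show "(LBINT p. c u * ?D (p / n) * cis (p * u)) =
        c u * (n * complex_of_real (exp (- (n * u)\<^sup>2 / 2)))"
      by (simp add: integral_std_normal_density_cis)
  qed
  also have "\<dots> = (LBINT t. c (t / n) * complex_of_real (exp (- t\<^sup>2 / 2)))"
    using n by (subst lborel_integral_real_affine[where c = "1 / n" and t = 0])
      (auto simp: scaleR_conv_of_real simp flip: integral_mult_right_zero)
  also have "\<dots> = (LBINT t. sqrt (2 * pi) * (c (t / n) * ?D t))"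
    by (rule Bochner_Integration.integral_cong[OF refl]) (simp add: std_normal_density_def)
  finally have "(LBINT p. fourier c p * ?D (p / n)) = sqrt (2 * pi) * (LBINT t. c (t / n) * ?D t)"
    by simp
  \<comment> \<open>The density hides a factor \<open>1 / sqrt (2 * pi)\<close>. A second root
    restores the bare Gaussian on the left and completes \<open>2 * pi\<close> on the right.\<close>
  then have "complex_of_real (sqrt (2 * pi)) * (LBINT p. fourier c p * ?D (p / n)) =
      complex_of_real (sqrt (2 * pi) * sqrt (2 * pi)) * (LBINT t. c (t / n) * ?D t)"
    by (simp only: of_real_mult mult.assoc)
  then show ?thesis
    unfolding E by (simp add: ac_simps flip: integral_mult_right_zero)
qed

section \<open>Correlations and the upper bound in Plancherel's theorem\<close>

text \<open>By translation invariance the integral of the norms over \<open>h\<close> depends on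
  \<open>u\<close> only through \<open>norm (H u)\<close>, so the iterated integral is the product
  of the two L1 norms.\<close>

lemma integrable_correlation_pair:
  fixes F H :: "real \<Rightarrow> complex"
  assumes F: "integrable lborel F" and H: "integrable lborel H"
  shows "integrable (lborel \<Otimes>\<^sub>M lborel) (\<lambda>(u, h). cnj (H u) * F (u + h))"
proof (rule lborel_pair.Fubini_integrable)
  have [measurable]: "F \<in> borel_measurable borel" "H \<in> borel_measurable borel"
    using F H by auto
  show "(\<lambda>(u, h). cnj (H u) * F (u + h)) \<in> borel_measurable (lborel \<Otimes>\<^sub>M lborel)"
    by measurable
  have Fu: "integrable lborel (\<lambda>h. F (u + h))" for u
    using lborel_integrable_real_affine[OF F, of 1 u] by simp
  have "(LBINT h. norm (F (u + h))) = (LBINT h. norm (F h))" for u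
    using lborel_integral_real_affine[of 1 "\<lambda>h. norm (F h)" u] by simp
  then show "integrable lborel (\<lambda>u. LBINT h. norm (case (u, h) of (u, h) \<Rightarrow> cnj (H u) * F (u + h)))"
    using H by (simp add: norm_mult)
  show "AE u in lborel. integrable lborel (\<lambda>h. case (u, h) of (u, h) \<Rightarrow> cnj (H u) * F (u + h))"
    using Fu by simp
qed

lemma integrable_correlation:
  fixes F H :: "real \<Rightarrow> complex"
  assumes F: "integrable lborel F" and H: "integrable lborel H"
  shows "integrable lborel (\<lambda>h. LBINT u. cnj (H u) * F (u + h))"
  using lborel_pair.integrable_snd[OF integrable_correlation_pair[OF assms]] by simp

text \<open>Writing \<open>cis (p * h)\<close> as \<open>cis (- (p * u)) * cis (p * (u + h))\<close>
  splits the double integral into a product. For \<open>H = F\<close> this exhibits the squared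
  modulus of \<open>fourier F\<close> as the transform of an integrable function.\<close>

lemma fourier_correlation:
  fixes F H :: "real \<Rightarrow> complex"
  assumes F: "integrable lborel F" and H: "integrable lborel H"
  shows "fourier (\<lambda>h. LBINT u. cnj (H u) * F (u + h)) p = cnj (fourier H p) * fourier F p"
proof -
  have [measurable]: "F \<in> borel_measurable borel" "H \<in> borel_measurable borel"
    using F H by auto
  have I: "integrable (lborel \<Otimes>\<^sub>M lborel) (\<lambda>(u, h). cnj (H u) * F (u + h) * cis (p * h))"
    using integrable_mult_cis[OF integrable_correlation_pair[OF F H], of "\<lambda>(u, h). p * h"]
    by (simp add: case_prod_beta')
  have "fourier (\<lambda>h. LBINT u. cnj (H u) * F (u + h)) p =
      (LBINT h. LBINT u. cnj (H u) * F (u + h) * cis (p * h))"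
    unfolding fourier_def by (simp flip: integral_mult_left_zero)
  also have "\<dots> = (LBINT u. LBINT h. cnj (H u) * F (u + h) * cis (p * h))"
    using lborel_pair.Fubini_integral[OF I] by simp
  also have "\<dots> = (LBINT u. cnj (H u * cis (p * u)) * fourier F p)"
  proof (rule Bochner_Integration.integral_cong[OF refl])
    fix u
    have "(LBINT h. cnj (H u) * F (u + h) * cis (p * h)) =
        cnj (H u) * cis (- (p * u)) * (LBINT h. F (u + h) * cis (p * (u + h)))"
      by (simp add: ring_distribs ac_simps cis_mult flip: integral_mult_right_zero)
    also have "(LBINT h. F (u + h) * cis (p * (u + h))) = fourier F p"
      unfolding fourier_def
      using lborel_integral_real_affine[of 1 "\<lambda>h. F h * cis (p * h)" u] by simp
    finally show "(LBINT h. cnj (H u) * F (u + h) * cis (p * h)) = cnj (H u * cis (p * u)) * fourier F p"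
      by (simp add: cis_cnj)
  qed
  also have "\<dots> = cnj (fourier H p) * fourier F p"
    unfolding fourier_def integral_mult_left_zero Bochner_Integration.integral_cnj ..
  finally show ?thesis .
qed

text \<open>The squared modulus of \<open>fourier F\<close> is the transform of the autocorrelation
  of \<open>F\<close>, which is bounded by the squared L2 norm of \<open>F\<close>. Its Gaussian
  means are thus bounded uniformly in the width, and Fatou's lemma lets the width tend to
  infinity.\<close>

lemma nn_integral_fourier_le:
  fixes F :: "real \<Rightarrow> complex"
  assumes F: "integrable lborel F"
  shows "(\<integral>\<^sup>+p. ennreal ((norm (fourier F p))\<^sup>2) \<partial>lborel) \<le>
    ennreal (2 * pi) * (\<integral>\<^sup>+u. ennreal ((norm (F u))\<^sup>2) \<partial>lborel)"
proof (cases "(\<integral>\<^sup>+u. ennreal ((norm (F u))\<^sup>2) \<partial>lborel) = \<infinity>")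
  case True
  then show ?thesis
    by (simp add: ennreal_mult_top)
next
  case False
  have [measurable]: "F \<in> borel_measurable borel"
    using F by auto
  define S where "S = (LBINT u. (norm (F u))\<^sup>2)"
  have F2: "integrable lborel (\<lambda>u. (norm (F u))\<^sup>2)"
    using False by (intro integrableI_bounded) (auto simp: top.not_eq_extremum)
  have S: "(\<integral>\<^sup>+u. ennreal ((norm (F u))\<^sup>2) \<partial>lborel) = ennreal S"
    unfolding S_def by (intro nn_integral_eq_integral F2) simp
  define c where "c h = (LBINT u. cnj (F u) * F (u + h))" for h
  have c: "integrable lborel c"
    unfolding c_def by (rule integrable_correlation[OF F F])
  have fc: "fourier c p = complex_of_real ((norm (fourier F p))\<^sup>2)" for p
    unfolding c_def fourier_correlation[OF F F] by (simp only: complex_norm_square mult.commute)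
  \<comment> \<open>AM-GM under the integral; both squares integrate to \<open>S\<close> by
    translation invariance.\<close>
  have c_le: "norm (c h) \<le> S" for h
  proof -
    have F2h: "integrable lborel (\<lambda>u. (norm (F (u + h)))\<^sup>2)"
      using lborel_integrable_real_affine[OF F2, of 1 h] by (simp add: add.commute)
    have Sh: "(LBINT u. (norm (F (u + h)))\<^sup>2) = S"
      using lborel_integral_real_affine[of 1 "\<lambda>u. (norm (F u))\<^sup>2" h] by (simp add: add.commute S_def)
    have "norm (c h) \<le> (LBINT u. ((norm (F u))\<^sup>2 + (norm (F (u + h)))\<^sup>2) / 2)"
      unfolding c_def
    proof (rule integral_norm_le_integral)
      show "integrable lborel (\<lambda>u. ((norm (F u))\<^sup>2 + (norm (F (u + h)))\<^sup>2) / 2)"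
        using F2 F2h by simp
      show "norm (cnj (F u) * F (u + h)) \<le> ((norm (F u))\<^sup>2 + (norm (F (u + h)))\<^sup>2) / 2" for u
        using sum_squares_bound[of "norm (F u)" "norm (F (u + h))"] by (simp add: norm_mult)
    qed
    also have "\<dots> = S"
      using F2 F2h Sh by (simp add: S_def)
    finally show ?thesis .
  qed
  let ?E = "\<lambda>n p. exp (- (p / real (Suc n))\<^sup>2 / 2)"
  \<comment> \<open>The bound is the same for all \<open>n\<close> because the normal density has
    total mass 1.\<close>
  have bnd: "(\<integral>\<^sup>+p. ennreal ((norm (fourier F p))\<^sup>2 * ?E n p) \<partial>lborel) \<le> ennreal (2 * pi * S)" for n
  proof -
    have "norm (fourier F p) \<le> (LBINT u. norm (F u))" for p
      by (rule norm_fourier_le)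
    then have b: "(norm (fourier F p))\<^sup>2 \<le> (LBINT u. norm (F u))\<^sup>2" for p
      by (intro power_mono) auto
    have gauss: "integrable lborel (?E n)"
      by (rule integrable_gaussian) simp
    have i: "integrable lborel (\<lambda>p. (norm (fourier F p))\<^sup>2 * ?E n p)"
      by (rule Bochner_Integration.integrable_bound[OF integrable_mult_right[OF gauss, of "(LBINT u. norm (F u))\<^sup>2"]])
         (use b in \<open>auto simp: abs_mult intro!: mult_right_mono\<close>)
    have "complex_of_real (LBINT p. (norm (fourier F p))\<^sup>2 * ?E n p) =
        2 * pi * (LBINT t. c (t / real (Suc n)) * complex_of_real (std_normal_density t))"
      using fourier_gaussian_mean[OF c, of "real (Suc n)"]
      by (simp add: fc flip: integral_complex_of_real)
    then have "\<bar>LBINT p. (norm (fourier F p))\<^sup>2 * ?E n p\<bar> =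
        2 * pi * norm (LBINT t. c (t / real (Suc n)) * complex_of_real (std_normal_density t))"
      by (simp only: norm_mult flip: norm_of_real[where 'a = complex]) simp
    also have "norm (LBINT t. c (t / real (Suc n)) * complex_of_real (std_normal_density t))
        \<le> (LBINT t. S * std_normal_density t)"
      by (rule integral_norm_le_integral)
         (auto simp: norm_mult intro!: mult_right_mono c_le)
    finally have "(LBINT p. (norm (fourier F p))\<^sup>2 * ?E n p) \<le> 2 * pi * S"
      by simp
    then show ?thesis
      using i by (subst nn_integral_eq_integral) (auto intro: ennreal_leI)
  qed
  \<comment> \<open>The Gaussian factor tends to 1 pointwise, so Fatou's lemma removes it.\<close>
  have "(\<integral>\<^sup>+p. ennreal ((norm (fourier F p))\<^sup>2) \<partial>lborel) =
      (\<integral>\<^sup>+p. liminf (\<lambda>n. ennreal ((norm (fourier F p))\<^sup>2 * ?E n p)) \<partial>lborel)"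
  proof (rule nn_integral_cong)
    fix p
    have "(\<lambda>n. p / real (Suc n)) \<longlonglongrightarrow> 0"
      by real_asymp
    then have "(\<lambda>n. (norm (fourier F p))\<^sup>2 * ?E n p) \<longlonglongrightarrow> (norm (fourier F p))\<^sup>2 * exp (- 0\<^sup>2 / 2)"
      by (intro tendsto_intros) auto
    then have "(\<lambda>n. ennreal ((norm (fourier F p))\<^sup>2 * ?E n p)) \<longlonglongrightarrow> ennreal ((norm (fourier F p))\<^sup>2)"
      by (intro tendsto_ennrealI) simp
    then show "ennreal ((norm (fourier F p))\<^sup>2) = liminf (\<lambda>n. ennreal ((norm (fourier F p))\<^sup>2 * ?E n p))"
      by (metis lim_imp_Liminf trivial_limit_sequentially)
  qed
  also have "\<dots> \<le> liminf (\<lambda>n. \<integral>\<^sup>+p. ennreal ((norm (fourier F p))\<^sup>2 * ?E n p) \<partial>lborel)"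
    by (rule nn_integral_liminf) simp
  also have "\<dots> \<le> liminf (\<lambda>_::nat. ennreal (2 * pi * S))"
    by (intro Liminf_mono always_eventually allI bnd)
  also have "\<dots> = ennreal (2 * pi * S)"
    by (rule Liminf_const[OF trivial_limit_sequentially])
  finally show ?thesis
    by (simp add: S ennreal_mult')
qed

text \<open>The lower bound in Plancherel's theorem by duality: AM-GM applied to \<open>cnj (fourier H) * fourier F\<close>.
  Continuity of the test function \<open>H\<close> lets dominated convergence replace the \<open>L\<^sup>1\<close>-continuity of
  translations.\<close>

lemma fourier_test_function_bound:
  fixes F H :: "real \<Rightarrow> complex"
  assumes F: "integrable lborel F" and H: "integrable lborel H"
    and cont: "continuous_on UNIV H" and B: "\<And>u. norm (H u) \<le> B"
  shows "ennreal (2 * pi * (2 * Re (LBINT u. cnj (H u) * F u) - (LBINT u. (norm (H u))\<^sup>2))) \<le>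
    (\<integral>\<^sup>+p. ennreal ((norm (fourier F p))\<^sup>2) \<partial>lborel)"
proof (cases "(\<integral>\<^sup>+p. ennreal ((norm (fourier F p))\<^sup>2) \<partial>lborel) = \<infinity>")
  case True
  then show ?thesis
    by simp
next
  case False
  have [measurable]: "F \<in> borel_measurable borel" "H \<in> borel_measurable borel"
    using F H by auto
  have "0 \<le> B"
    using B[of 0] norm_ge_zero[of "H 0"] by linarith
  define W where "W = (LBINT p. (norm (fourier F p))\<^sup>2)"
  have F2: "integrable lborel (\<lambda>p. (norm (fourier F p))\<^sup>2)"
    using False by (intro integrableI_bounded) (auto simp: top.not_eq_extremum)
  then have W: "(\<integral>\<^sup>+p. ennreal ((norm (fourier F p))\<^sup>2) \<partial>lborel) = ennreal W"
    unfolding W_def by (intro nn_integral_eq_integral) auto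
  define S where "S = (LBINT u. (norm (H u))\<^sup>2)"
  have H2: "integrable lborel (\<lambda>u. (norm (H u))\<^sup>2)"
    by (rule Bochner_Integration.integrable_bound[OF integrable_mult_right[OF integrable_norm[OF H], of B]])
       (use B \<open>0 \<le> B\<close> in \<open>auto simp: power2_eq_square intro!: mult_right_mono\<close>)
  have S: "(\<integral>\<^sup>+u. ennreal ((norm (H u))\<^sup>2) \<partial>lborel) = ennreal S"
    unfolding S_def by (intro nn_integral_eq_integral H2) simp
  have nH: "(\<integral>\<^sup>+p. ennreal ((norm (fourier H p))\<^sup>2) \<partial>lborel) \<le> ennreal (2 * pi * S)"
    using nn_integral_fourier_le[OF H] by (simp add: S ennreal_mult')
  have fH2: "integrable lborel (\<lambda>p. (norm (fourier H p))\<^sup>2)"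
    using nH by (intro integrableI_bounded) (auto intro: le_less_trans)
  have SH: "(LBINT p. (norm (fourier H p))\<^sup>2) \<le> 2 * pi * S"
    using nH S_def fH2 by (simp add: nn_integral_eq_integral)
  define c where "c h = (LBINT u. cnj (H u) * F (u + h))" for h
  have c: "integrable lborel c"
    unfolding c_def by (rule integrable_correlation[OF F H])
  have [measurable]: "c \<in> borel_measurable borel"
    using c by auto
  \<comment> \<open>The shift is moved from \<open>F\<close>, which is merely integrable, to the
    continuous \<open>H\<close>.\<close>
  have c': "c h = (LBINT u. cnj (H (u - h)) * F u)" for h
    unfolding c_def using lborel_integral_real_affine[of 1 "\<lambda>u. cnj (H (u - h)) * F u" h]
    by (simp add: add.commute)
  have c_le: "norm (c h) \<le> (LBINT u. B * norm (F u))" for h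
    unfolding c' using F B by (intro integral_norm_le_integral) (auto simp: norm_mult intro!: mult_right_mono)
  let ?D = "\<lambda>t. complex_of_real (std_normal_density t)"
  have bnd: "norm (LBINT t. c (t / real (Suc n)) * ?D t) * (2 * pi) \<le> (2 * pi * S + W) / 2" for n
  proof -
    have "norm (LBINT p. fourier c p * complex_of_real (exp (- (p / real (Suc n))\<^sup>2 / 2))) \<le>
        (LBINT p. ((norm (fourier H p))\<^sup>2 + (norm (fourier F p))\<^sup>2) / 2)"
    proof (rule integral_norm_le_integral)
      show "integrable lborel (\<lambda>p. ((norm (fourier H p))\<^sup>2 + (norm (fourier F p))\<^sup>2) / 2)"
        using fH2 F2 by simp
      fix p
      have "norm (fourier c p * complex_of_real (exp (- (p / real (Suc n))\<^sup>2 / 2))) =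
          norm (fourier H p) * norm (fourier F p) * exp (- (p / real (Suc n))\<^sup>2 / 2)"
        unfolding c_def fourier_correlation[OF F H] by (simp add: norm_mult)
      also have "\<dots> \<le> norm (fourier H p) * norm (fourier F p)"
        by (intro mult_left_le) auto
      also have "\<dots> \<le> ((norm (fourier H p))\<^sup>2 + (norm (fourier F p))\<^sup>2) / 2"
        using sum_squares_bound[of "norm (fourier H p)" "norm (fourier F p)"] by simp
      finally show "norm (fourier c p * complex_of_real (exp (- (p / real (Suc n))\<^sup>2 / 2))) \<le>
          ((norm (fourier H p))\<^sup>2 + (norm (fourier F p))\<^sup>2) / 2" .
    qed
    also have "\<dots> = ((LBINT p. (norm (fourier H p))\<^sup>2) + W) / 2"
      using fH2 F2 by (simp add: W_def)
    also have "\<dots> \<le> (2 * pi * S + W) / 2"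
      using SH by (intro divide_right_mono add_right_mono) auto
    finally show ?thesis
      using fourier_gaussian_mean[OF c, of "real (Suc n)"] by (simp add: norm_mult ac_simps)
  qed
  have lim_c: "(\<lambda>n. c (t / real (Suc n))) \<longlonglongrightarrow> c 0" for t
  proof -
    have "(\<lambda>n. LBINT u. cnj (H (u - t / real (Suc n))) * F u) \<longlonglongrightarrow> (LBINT u. cnj (H (u - 0)) * F u)"
    proof (rule integral_dominated_convergence[where w = "\<lambda>u. B * norm (F u)"])
      show "AE u in lborel. (\<lambda>n. cnj (H (u - t / real (Suc n))) * F u) \<longlonglongrightarrow> cnj (H (u - 0)) * F u"
      proof (rule AE_I2)
        fix u
        have "(\<lambda>n. u - t / real (Suc n)) \<longlonglongrightarrow> u - 0"
          by (intro tendsto_diff tendsto_const) real_asymp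
        moreover have "isCont H (u - 0)"
          using cont by (simp add: continuous_on_eq_continuous_at)
        ultimately have "(\<lambda>n. H (u - t / real (Suc n))) \<longlonglongrightarrow> H (u - 0)"
          by (rule isCont_tendsto_compose[rotated])
        then show "(\<lambda>n. cnj (H (u - t / real (Suc n))) * F u) \<longlonglongrightarrow> cnj (H (u - 0)) * F u"
          by (intro tendsto_mult tendsto_cnj tendsto_const)
      qed
    qed (use F B in \<open>auto simp: norm_mult intro!: mult_right_mono\<close>)
    then show ?thesis
      by (simp add: c')
  qed
  \<comment> \<open>Widening the Gaussian concentrates the mean at \<open>c 0\<close>, the inner
    product of \<open>H\<close> and \<open>F\<close>. The uniform bound on \<open>c\<close> times
    the normal density is the majorant.\<close>
  have "(\<lambda>n. LBINT t. c (t / real (Suc n)) * ?D t) \<longlonglongrightarrow> (LBINT t. c 0 * ?D t)"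
  proof (rule integral_dominated_convergence[where w = "\<lambda>t. (LBINT u. B * norm (F u)) * std_normal_density t"])
    show "AE t in lborel. (\<lambda>n. c (t / real (Suc n)) * ?D t) \<longlonglongrightarrow> c 0 * ?D t"
      by (intro AE_I2 tendsto_mult lim_c tendsto_const)
    show "AE t in lborel. norm (c (t / real (Suc n)) * ?D t) \<le> (LBINT u. B * norm (F u)) * std_normal_density t" for n
      using c_le by (intro AE_I2) (auto simp: norm_mult simp del: integral_mult_right_zero intro!: mult_right_mono)
  qed (auto simp del: integral_mult_right_zero)
  then have "(\<lambda>n. norm (LBINT t. c (t / real (Suc n)) * ?D t) * (2 * pi)) \<longlonglongrightarrow> norm (LBINT t. c 0 * ?D t) * (2 * pi)"
    by (intro tendsto_mult tendsto_norm tendsto_const)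
  then have "norm (LBINT t. c 0 * ?D t) * (2 * pi) \<le> (2 * pi * S + W) / 2"
    by (rule LIMSEQ_le_const2) (use bnd in blast)
  then have "norm (c 0) * (2 * pi) \<le> (2 * pi * S + W) / 2"
    by (simp add: integral_complex_of_real)
  moreover have "Re (c 0) * (2 * pi) \<le> norm (c 0) * (2 * pi)"
    by (intro mult_right_mono complex_Re_le_cmod) simp
  ultimately have "Re (c 0) * (2 * pi) \<le> (2 * pi * S + W) / 2"
    by linarith
  then have "2 * pi * (2 * Re (c 0) - S) \<le> W"
    by (simp add: algebra_simps)
  then show ?thesis
    unfolding W by (intro ennreal_leI) (simp add: c_def S_def)
qed

text \<open>A measurable function is an almost everywhere limit of continuous functions, but these
  come without bounds. Multiplying by a plateau function and scaling the values back into the ball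
  of radius \<open>n\<close> gives a common integrable majorant and leaves the limit
  unchanged.\<close>

lemma continuous_approximation_of_truncation:
  fixes F :: "real \<Rightarrow> complex"
  assumes [measurable]: "F \<in> borel_measurable borel" and "n > 0"
  obtains H :: "nat \<Rightarrow> real \<Rightarrow> complex"
  where "\<And>k. continuous_on UNIV (H k)"
    and "\<And>k u. norm (H k u) \<le> n * indicator {-n-1..n+1} u"
    and "AE u in lborel. (\<lambda>k. H k u) \<longlonglongrightarrow> (if \<bar>u\<bar> \<le> n \<and> norm (F u) \<le> n then F u else 0)"
proof -
  define G where "G u = (if \<bar>u\<bar> \<le> n \<and> norm (F u) \<le> n then F u else 0)" for u
  have "G \<in> borel_measurable borel"
    unfolding G_def by measurable
  then have "G measurable_on UNIV"
    by (intro lebesgue_measurable_imp_measurable_on) (auto intro: measurable_completion)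
  then obtain N g where N: "negligible N" and g: "\<And>k. continuous_on UNIV (g k)"
    and lim: "\<And>u. u \<notin> N \<Longrightarrow> (\<lambda>k. g k u) \<longlonglongrightarrow> G u"
    unfolding measurable_on_def by auto
  \<comment> \<open>\<open>w\<close> is 1 on \<open>[-n, n]\<close> and 0 outside
    \<open>[-n-1, n+1]\<close>.\<close>
  define w where "w u = max 0 (min 1 (n + 1 - \<bar>u\<bar>))" for u
  define H where "H k u = complex_of_real (w u / max 1 (norm (g k u) / n)) * g k u" for k u
  show ?thesis
  proof
    show "continuous_on UNIV (H k)" for k
      unfolding H_def w_def using \<open>n > 0\<close> by (intro continuous_intros g) auto
    show "norm (H k u) \<le> n * indicator {-n-1..n+1} u" for k u
    proof -
      have "norm (g k u) \<le> n * max 1 (norm (g k u) / n)"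
        using \<open>n > 0\<close> by (auto simp: max_def field_simps)
      then have 1: "norm (g k u) / max 1 (norm (g k u) / n) \<le> n"
        by (subst divide_le_eq) auto
      have 2: "0 \<le> w u" "w u \<le> indicator {-n-1..n+1} u"
        by (auto simp: w_def indicator_def)
      have "norm (H k u) = (norm (g k u) / max 1 (norm (g k u) / n)) * w u"
        using 2 by (simp add: H_def norm_mult norm_divide)
      also have "\<dots> \<le> n * indicator {-n-1..n+1} u"
        using 1 2 \<open>n > 0\<close> by (intro mult_mono) auto
      finally show ?thesis .
    qed
    have "AE u in lborel. u \<notin> N"
      using N by (metis AE_not_in negligible_iff_null_sets AE_completion_iff)
    then show "AE u in lborel. (\<lambda>k. H k u) \<longlonglongrightarrow> (if \<bar>u\<bar> \<le> n \<and> norm (F u) \<le> n then F u else 0)"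
    proof eventually_elim
      case (elim u)
      have "(\<lambda>k. H k u) \<longlonglongrightarrow> complex_of_real (w u / max 1 (norm (G u) / n)) * G u"
        unfolding H_def using \<open>n > 0\<close> by (intro tendsto_intros lim elim) auto
      \<comment> \<open>Where \<open>G u\<close> is nonzero, \<open>\<bar>u\<bar> \<le> n\<close>
        gives \<open>w u = 1\<close>, and \<open>norm (G u) \<le> n\<close> makes the denominator
        1.\<close>
      also have "complex_of_real (w u / max 1 (norm (G u) / n)) * G u = G u"
        using \<open>n > 0\<close> by (auto simp: G_def w_def max_def field_simps)
      finally show ?case
        by (simp add: G_def)
    qed
  qed
qed

text \<open>The missing inequality comes from testing with continuous approximations of the
  truncations \<open>G n\<close> and then letting \<open>n\<close> grow. Extended integrals are used
  because an integrable \<open>F\<close> may fail to be square integrable; both sides are then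
  infinite.\<close>

theorem nn_integral_fourier:
  fixes F :: "real \<Rightarrow> complex"
  assumes F: "integrable lborel F"
  shows "(\<integral>\<^sup>+p. ennreal ((norm (fourier F p))\<^sup>2) \<partial>lborel) =
    ennreal (2 * pi) * (\<integral>\<^sup>+u. ennreal ((norm (F u))\<^sup>2) \<partial>lborel)"
proof (rule antisym[OF nn_integral_fourier_le[OF F]])
  have [measurable]: "F \<in> borel_measurable borel"
    using F by auto
  define W where "W = (\<integral>\<^sup>+p. ennreal ((norm (fourier F p))\<^sup>2) \<partial>lborel)"
  \<comment> \<open>\<open>Suc n\<close> keeps the truncation level positive, as the approximation
    lemma demands.\<close>
  define G where "G n u = (if \<bar>u\<bar> \<le> real (Suc n) \<and> norm (F u) \<le> real (Suc n) then F u else 0)" for n u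
  have [measurable]: "G n \<in> borel_measurable borel" for n
    unfolding G_def by measurable
  have G_le: "ennreal (2 * pi) * (\<integral>\<^sup>+u. ennreal ((norm (G n u))\<^sup>2) \<partial>lborel) \<le> W" for n
  proof -
    define N where "N = real (Suc n)"
    have "N > 0"
      by (simp add: N_def)
    obtain H where cont: "\<And>k. continuous_on UNIV (H k)"
      and bnd: "\<And>k u. norm (H k u) \<le> N * indicator {-N-1..N+1} u"
      and lim: "AE u in lborel. (\<lambda>k. H k u) \<longlonglongrightarrow> G n u"
      using continuous_approximation_of_truncation[of F N] \<open>N > 0\<close> unfolding G_def N_def by auto
    have [measurable]: "H k \<in> borel_measurable borel" for k
      by (intro borel_measurable_continuous_onI cont)
    have bnd': "norm (H k u) \<le> N" for k u
      using bnd[of k u] \<open>N > 0\<close> by (cases "u \<in> {-N-1..N+1}") (auto simp: indicator_def)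
    have ind: "integrable lborel (\<lambda>u. K * indicator {-N-1..N+1} u :: real)" for K
      by (intro integrable_mult_right integrable_real_indicator) (auto simp: emeasure_lborel_Icc_eq)
    have H: "integrable lborel (H k)" for k
      by (rule Bochner_Integration.integrable_bound[OF ind[of N]]) (use bnd \<open>N > 0\<close> in auto)
    have 1: "(\<lambda>k. LBINT u. cnj (H k u) * F u) \<longlonglongrightarrow> (LBINT u. cnj (G n u) * F u)"
    proof (rule integral_dominated_convergence[where w = "\<lambda>u. N * norm (F u)"])
      show "AE u in lborel. (\<lambda>k. cnj (H k u) * F u) \<longlonglongrightarrow> cnj (G n u) * F u"
        using lim by eventually_elim (intro tendsto_intros)
    qed (use F bnd' in \<open>auto simp: norm_mult intro!: mult_right_mono\<close>)
    have 2: "(\<lambda>k. LBINT u. (norm (H k u))\<^sup>2) \<longlonglongrightarrow> (LBINT u. (norm (G n u))\<^sup>2)"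
    proof (rule integral_dominated_convergence[where w = "\<lambda>u. N\<^sup>2 * indicator {-N-1..N+1} u"])
      show "AE u in lborel. (\<lambda>k. (norm (H k u))\<^sup>2) \<longlonglongrightarrow> (norm (G n u))\<^sup>2"
        using lim by eventually_elim (intro tendsto_intros)
      show "AE u in lborel. norm ((norm (H k u))\<^sup>2) \<le> N\<^sup>2 * indicator {-N-1..N+1} u" for k
      proof (rule AE_I2)
        fix u
        have "(norm (H k u))\<^sup>2 \<le> (N * indicator {-N-1..N+1} u)\<^sup>2"
          by (rule power_mono[OF bnd]) simp
        then show "norm ((norm (H k u))\<^sup>2) \<le> N\<^sup>2 * indicator {-N-1..N+1} u"
          by (cases "u \<in> {-N-1..N+1}") simp_all
      qed
    qed (use ind in auto)
    \<comment> \<open>\<open>G n u\<close> is either \<open>F u\<close> or 0, so pairing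
      \<open>G n\<close> with \<open>F\<close> gives the squared norm of \<open>G n\<close>, and the
      duality bound collapses to \<open>2 * pi\<close> times that norm.\<close>
    have "(LBINT u. cnj (G n u) * F u) = (LBINT u. complex_of_real ((norm (G n u))\<^sup>2))"
      by (rule Bochner_Integration.integral_cong[OF refl])
         (simp add: G_def complex_norm_square mult.commute del: of_real_power)
    then have 3: "Re (LBINT u. cnj (G n u) * F u) = (LBINT u. (norm (G n u))\<^sup>2)"
      by (simp add: integral_complex_of_real del: of_real_power)
    have "(\<lambda>k. ennreal (2 * pi * (2 * Re (LBINT u. cnj (H k u) * F u) - (LBINT u. (norm (H k u))\<^sup>2))))
        \<longlonglongrightarrow> ennreal (2 * pi * (2 * Re (LBINT u. cnj (G n u) * F u) - (LBINT u. (norm (G n u))\<^sup>2)))"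
      by (intro tendsto_ennrealI tendsto_intros 1 2)
    then have "ennreal (2 * pi * (2 * Re (LBINT u. cnj (G n u) * F u) - (LBINT u. (norm (G n u))\<^sup>2))) \<le> W"
      by (rule LIMSEQ_le_const2) (use fourier_test_function_bound[OF F H cont bnd'] in \<open>auto simp: W_def\<close>)
    then have "ennreal (2 * pi * (LBINT u. (norm (G n u))\<^sup>2)) \<le> W"
      unfolding 3 by simp
    moreover have "integrable lborel (\<lambda>u. (norm (G n u))\<^sup>2)"
    proof (rule Bochner_Integration.integrable_bound[OF ind[of "N\<^sup>2"]])
      show "AE u in lborel. norm ((norm (G n u))\<^sup>2) \<le> norm (N\<^sup>2 * indicator {-N-1..N+1} u)"
        by (intro AE_I2) (auto simp: G_def N_def indicator_def intro!: power_mono)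
    qed simp
    ultimately show ?thesis
      by (simp add: nn_integral_eq_integral ennreal_mult')
  qed
  have "ennreal (2 * pi) * (\<integral>\<^sup>+u. ennreal ((norm (F u))\<^sup>2) \<partial>lborel) =
      (\<integral>\<^sup>+u. ennreal (2 * pi) * ennreal ((norm (F u))\<^sup>2) \<partial>lborel)"
    by (simp add: nn_integral_cmult)
  \<comment> \<open>At each fixed \<open>u\<close> the truncation is eventually inactive, so Fatou's
    lemma passes from the \<open>G n\<close> to \<open>F\<close>.\<close>
  also have "\<dots> = (\<integral>\<^sup>+u. liminf (\<lambda>n. ennreal (2 * pi) * ennreal ((norm (G n u))\<^sup>2)) \<partial>lborel)"
  proof (rule nn_integral_cong)
    fix u
    obtain m :: nat where m: "max \<bar>u\<bar> (norm (F u)) \<le> real m"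
      using real_arch_simple by blast
    have "eventually (\<lambda>n. ennreal (2 * pi) * ennreal ((norm (G n u))\<^sup>2) =
        ennreal (2 * pi) * ennreal ((norm (F u))\<^sup>2)) sequentially"
      using eventually_ge_at_top[of m] by eventually_elim (use m in \<open>auto simp: G_def\<close>)
    then have "(\<lambda>n. ennreal (2 * pi) * ennreal ((norm (G n u))\<^sup>2)) \<longlonglongrightarrow>
        ennreal (2 * pi) * ennreal ((norm (F u))\<^sup>2)"
      by (rule tendsto_eventually)
    then show "ennreal (2 * pi) * ennreal ((norm (F u))\<^sup>2) =
        liminf (\<lambda>n. ennreal (2 * pi) * ennreal ((norm (G n u))\<^sup>2))"
      by (rule lim_imp_Liminf[OF trivial_limit_sequentially, symmetric])
  qed
  also have "\<dots> \<le> liminf (\<lambda>n. \<integral>\<^sup>+u. ennreal (2 * pi) * ennreal ((norm (G n u))\<^sup>2) \<partial>lborel)"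
    by (rule nn_integral_liminf) simp
  also have "\<dots> \<le> liminf (\<lambda>_::nat. W)"
  proof (intro Liminf_mono always_eventually allI)
    show "(\<integral>\<^sup>+u. ennreal (2 * pi) * ennreal ((norm (G n u))\<^sup>2) \<partial>lborel) \<le> W" for n
      using G_le[of n] by (subst nn_integral_cmult) auto
  qed
  also have "\<dots> = W"
    by (rule Liminf_const[OF trivial_limit_sequentially])
  finally show "ennreal (2 * pi) * (\<integral>\<^sup>+u. ennreal ((norm (F u))\<^sup>2) \<partial>lborel) \<le> W" .
qed

section \<open>Linear and exponential phases\<close>

text \<open>\<open>subst\<close> is the change of variables \<open>u = s x\<close> with image
  \<open>R\<close> and Jacobian \<open>j\<close>. The density \<open>\<Phi> / j\<close>, carried to
  \<open>R\<close>, has the phase integral as its Fourier transform. Plancherel squares the density,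
  and returning to \<open>x\<close> restores one factor \<open>j\<close>, which leaves
  \<open>1 / j\<close>.\<close>

lemma nn_integral_fourier_substitution:
  fixes \<Phi> :: "real \<Rightarrow> complex" and s r j :: "real \<Rightarrow> real"
  assumes [measurable]: "s \<in> borel_measurable borel" "r \<in> borel_measurable borel"
      "j \<in> borel_measurable borel" "R \<in> sets borel"
    and inv: "\<And>x. r (s x) = x" and pos: "\<And>x. j x > 0"
    and subst: "\<And>h. h \<in> borel_measurable borel \<Longrightarrow>
      (\<integral>\<^sup>+u. h u * indicator R u \<partial>lborel) = (\<integral>\<^sup>+x. h (s x) * ennreal (j x) \<partial>lborel)"
    and \<Phi>: "integrable lborel \<Phi>"
  shows "(\<integral>\<^sup>+p. ennreal ((norm (LBINT x. \<Phi> x * cis (p * s x)))\<^sup>2) \<partial>lborel) =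
    (\<integral>\<^sup>+x. ennreal (2 * pi / j x * (norm (\<Phi> x))\<^sup>2) \<partial>lborel)"
proof -
  have [measurable]: "\<Phi> \<in> borel_measurable borel"
    using \<Phi> by auto
  define G where "G u = \<Phi> (r u) / complex_of_real (j (r u))" for u
  have G[measurable]: "G \<in> borel_measurable borel"
    unfolding G_def by measurable
  have Gs: "norm (G (s x)) = norm (\<Phi> x) / j x" for x
    using pos[of x] by (simp add: G_def inv norm_divide)
  \<comment> \<open>\<open>subst\<close> covers nonnegative integrands; read as an identity of
    measures it also transports the complex integrals below.\<close>
  have M: "density lborel (indicator R) = distr (density lborel (\<lambda>x. ennreal (j x))) borel s"
  proof (rule measure_eqI)
    fix X assume "X \<in> sets (density lborel (indicator R))"
    then have [measurable]: "X \<in> sets borel"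
      by simp
    have "emeasure (density lborel (indicator R)) X = (\<integral>\<^sup>+u. indicator X u * indicator R u \<partial>lborel)"
      by (subst emeasure_density) (auto simp: mult.commute)
    also have "\<dots> = (\<integral>\<^sup>+x. indicator X (s x) * ennreal (j x) \<partial>lborel)"
      by (rule subst) simp
    also have "\<dots> = emeasure (distr (density lborel (\<lambda>x. ennreal (j x))) borel s) X"
    proof -
      have [measurable]: "s -` X \<in> sets borel"
        by (rule measurable_sets_borel[of s borel X]) simp_all
      have "emeasure (distr (density lborel (\<lambda>x. ennreal (j x))) borel s) X =
          emeasure (density lborel (\<lambda>x. ennreal (j x))) (s -` X)"
        by (subst emeasure_distr) auto
      also have "\<dots> = (\<integral>\<^sup>+x. ennreal (j x) * indicator (s -` X) x \<partial>lborel)"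
        by (rule emeasure_density) auto
      also have "\<dots> = (\<integral>\<^sup>+x. indicator X (s x) * ennreal (j x) \<partial>lborel)"
        by (intro nn_integral_cong) (auto simp: indicator_def)
      finally show ?thesis ..
    qed
    finally show "emeasure (density lborel (indicator R)) X =
        emeasure (distr (density lborel (\<lambda>x. ennreal (j x))) borel s) X" .
  qed simp
  define F where "F u = indicator R u *\<^sub>R G u" for u
  have [measurable]: "F \<in> borel_measurable borel"
    unfolding F_def by measurable
  have "(\<integral>\<^sup>+u. ennreal (norm (F u)) \<partial>lborel) = (\<integral>\<^sup>+u. ennreal (norm (G u)) * indicator R u \<partial>lborel)"
    by (intro nn_integral_cong) (auto simp: F_def indicator_def)
  also have "\<dots> = (\<integral>\<^sup>+x. ennreal (norm (\<Phi> x)) \<partial>lborel)"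
    using pos by (subst subst) (auto simp: Gs less_imp_le less_imp_neq[symmetric] simp flip: ennreal_mult'')
  finally have F: "integrable lborel F"
    using \<Phi> by (intro integrableI_bounded) (auto simp: integrable_iff_bounded)
  have "fourier F p = (LBINT x. \<Phi> x * cis (p * s x))" for p
  proof -
    have "fourier F p = (LBINT u. indicator R u *\<^sub>R (G u * cis (p * u)))"
      unfolding fourier_def F_def by simp
    also have "\<dots> = (\<integral>u. G u * cis (p * u) \<partial>density lborel (indicator R))"
      by (subst integral_density[where g = "indicator R", symmetric]) (auto simp: ennreal_indicator)
    also have "\<dots> = (\<integral>x. G (s x) * cis (p * s x) \<partial>density lborel (\<lambda>x. ennreal (j x)))"
      unfolding M by (subst integral_distr) auto
    also have "\<dots> = (LBINT x. j x *\<^sub>R (G (s x) * cis (p * s x)))"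
      using pos by (subst integral_density) (auto simp: less_imp_le)
    also have "\<dots> = (LBINT x. \<Phi> x * cis (p * s x))"
      using pos by (intro Bochner_Integration.integral_cong)
        (auto simp: G_def inv scaleR_conv_of_real less_imp_neq[symmetric])
    finally show ?thesis .
  qed
  then have "(\<integral>\<^sup>+p. ennreal ((norm (LBINT x. \<Phi> x * cis (p * s x)))\<^sup>2) \<partial>lborel) =
      ennreal (2 * pi) * (\<integral>\<^sup>+u. ennreal ((norm (F u))\<^sup>2) \<partial>lborel)"
    using nn_integral_fourier[OF F] by simp
  also have "(\<integral>\<^sup>+u. ennreal ((norm (F u))\<^sup>2) \<partial>lborel) =
      (\<integral>\<^sup>+u. ennreal ((norm (G u))\<^sup>2) * indicator R u \<partial>lborel)"
    by (intro nn_integral_cong) (auto simp: F_def indicator_def)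
  also have "\<dots> = (\<integral>\<^sup>+x. ennreal ((norm (G (s x)))\<^sup>2) * ennreal (j x) \<partial>lborel)"
    by (rule subst) simp
  also have "ennreal (2 * pi) * \<dots> = (\<integral>\<^sup>+x. ennreal (2 * pi) * (ennreal ((norm (G (s x)))\<^sup>2) * ennreal (j x)) \<partial>lborel)"
    by (simp add: nn_integral_cmult)
  also have "\<dots> = (\<integral>\<^sup>+x. ennreal (2 * pi / j x * (norm (\<Phi> x))\<^sup>2) \<partial>lborel)"
  proof (rule nn_integral_cong)
    fix x
    have "2 * pi * ((norm (\<Phi> x) / j x)\<^sup>2 * j x) = 2 * pi / j x * (norm (\<Phi> x))\<^sup>2"
      using pos[of x] by (simp add: power2_eq_square)
    then show "ennreal (2 * pi) * (ennreal ((norm (G (s x)))\<^sup>2) * ennreal (j x)) =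
        ennreal (2 * pi / j x * (norm (\<Phi> x))\<^sup>2)"
      using pos[of x] by (simp add: Gs less_imp_le flip: ennreal_mult)
  qed
  finally show ?thesis .
qed

lemma nn_integral_linear_phase:
  fixes \<Phi> :: "real \<Rightarrow> complex"
  assumes "A \<noteq> 0" and "integrable lborel \<Phi>"
  shows "(\<integral>\<^sup>+p. ennreal ((norm (LBINT x. \<Phi> x * cis (p * (A * x))))\<^sup>2) \<partial>lborel) =
    (\<integral>\<^sup>+x. ennreal (2 * pi / \<bar>A\<bar> * (norm (\<Phi> x))\<^sup>2) \<partial>lborel)"
proof (rule nn_integral_fourier_substitution[where r = "\<lambda>u. u / A" and R = UNIV])
  show "(\<integral>\<^sup>+u. h u * indicator UNIV u \<partial>lborel) = (\<integral>\<^sup>+x. h (A * x) * ennreal \<bar>A\<bar> \<partial>lborel)"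
    if [measurable]: "h \<in> borel_measurable borel" for h :: "real \<Rightarrow> ennreal"
  proof -
    have "(\<integral>\<^sup>+x. h (A * x) * ennreal \<bar>A\<bar> \<partial>lborel) = (\<integral>\<^sup>+x. h (A * x) \<partial>lborel) * ennreal \<bar>A\<bar>"
      by (rule nn_integral_multc) simp
    then show ?thesis
      using nn_integral_real_affine[of h A 0] \<open>A \<noteq> 0\<close> by (simp add: mult.commute[of _ "ennreal \<bar>A\<bar>"])
  qed
qed (use assms in auto)

text \<open>The substitution rule holds on compact intervals; these exhaust both lines, and monotone
  convergence passes to the union.\<close>

lemma nn_integral_exp_substitution:
  fixes h :: "real \<Rightarrow> ennreal"
  assumes [measurable]: "h \<in> borel_measurable borel"
  shows "(\<integral>\<^sup>+u. h u * indicator {0<..} u \<partial>lborel) = (\<integral>\<^sup>+x. h (exp x) * ennreal (exp x) \<partial>lborel)"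
proof -
  \<comment> \<open>\<open>Suc n\<close> makes every interval nondegenerate, including the
    first.\<close>
  let ?I = "\<lambda>n. {exp (- real (Suc n))..exp (real (Suc n))}" and ?J = "\<lambda>n. {- real (Suc n)..real (Suc n)}"
  have "(\<integral>\<^sup>+u. h u * indicator {0<..} u \<partial>lborel) = (\<integral>\<^sup>+u. (SUP n. h u * indicator (?I n) u) \<partial>lborel)"
  proof (rule nn_integral_cong)
    fix u
    show "h u * indicator {0<..} u = (SUP n. h u * indicator (?I n) u)"
    proof (cases "u > 0")
      case True
      obtain m :: nat where m: "\<bar>ln u\<bar> \<le> real m"
        using real_arch_simple by blast
      then have "- real (Suc m) \<le> ln u" "ln u \<le> real (Suc m)"
        by auto
      then have "exp (- real (Suc m)) \<le> exp (ln u)" "exp (ln u) \<le> exp (real (Suc m))"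
        by (simp_all only: exp_le_cancel_iff)
      then have "u \<in> ?I m"
        using True by simp
      then show ?thesis
        using True by (intro antisym SUP_upper2[of m] SUP_least) (auto simp: indicator_def)
    next
      case False
      then have "u \<notin> ?I n" for n
        using False less_le_trans[OF exp_gt_zero, of "- real (Suc n)" u] by auto
      then show ?thesis
        using False by simp
    qed
  qed
  also have "\<dots> = (SUP n. \<integral>\<^sup>+u. h u * indicator (?I n) u \<partial>lborel)"
  proof (rule nn_integral_monotone_convergence_SUP)
    have mono: "indicator X u \<le> (indicator Y u :: ennreal)" if "X \<subseteq> Y" for X Y :: "real set" and u
      using that by (auto simp: indicator_def)
    have "?I n \<subseteq> ?I (Suc n)" for n
      by auto
    from mono[OF this] have "indicator (?I n) u \<le> (indicator (?I (Suc n)) u :: ennreal)" for n u .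
    then show "incseq (\<lambda>n u. h u * indicator (?I n) u)"
      by (intro incseq_SucI le_funI mult_left_mono) auto
  qed simp
  also have "\<dots> = (SUP n. \<integral>\<^sup>+x. h (exp x) * ennreal (exp x) * indicator (?J n) x \<partial>lborel)"
    by (intro SUP_cong refl nn_integral_substitution_aux) (auto intro!: derivative_eq_intros continuous_intros)
  also have "\<dots> = (\<integral>\<^sup>+x. (SUP n. h (exp x) * ennreal (exp x) * indicator (?J n) x) \<partial>lborel)"
    by (rule nn_integral_monotone_convergence_SUP[symmetric])
       (auto simp: incseq_def le_fun_def indicator_def)
  also have "\<dots> = (\<integral>\<^sup>+x. h (exp x) * ennreal (exp x) \<partial>lborel)"
  proof (rule nn_integral_cong)
    fix x :: real
    obtain m :: nat where m: "\<bar>x\<bar> \<le> real m"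
      using real_arch_simple by blast
    then have "x \<in> ?J m"
      by auto
    then show "(SUP n. h (exp x) * ennreal (exp x) * indicator (?J n) x) = h (exp x) * ennreal (exp x)"
      by (intro antisym SUP_upper2[of m] SUP_least) (auto simp: indicator_def)
  qed
  finally show ?thesis .
qed

text \<open>The phase function sweeps the half-line on the side of \<open>b\<close>, described for
  either sign by \<open>0 < u / b\<close>, with Jacobian
  \<open>\<bar>b\<bar> * \<epsilon> * exp (- \<epsilon> * x)\<close>.\<close>

lemma nn_integral_exponential_phase:
  fixes \<Phi> :: "real \<Rightarrow> complex"
  assumes "b \<noteq> 0" and "\<epsilon> > 0" and "integrable lborel \<Phi>"
  shows "(\<integral>\<^sup>+p. ennreal ((norm (LBINT x. \<Phi> x * cis (p * (b * exp (- \<epsilon> * x)))))\<^sup>2) \<partial>lborel) =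
    (\<integral>\<^sup>+x. ennreal (2 * pi / (\<bar>b\<bar> * \<epsilon> * exp (- \<epsilon> * x)) * (norm (\<Phi> x))\<^sup>2) \<partial>lborel)"
proof (rule nn_integral_fourier_substitution[where r = "\<lambda>u. - ln (u / b) / \<epsilon>" and R = "{u. 0 < u / b}"])
  show "(\<integral>\<^sup>+u. h u * indicator {u. 0 < u / b} u \<partial>lborel) =
      (\<integral>\<^sup>+x. h (b * exp (- \<epsilon> * x)) * ennreal (\<bar>b\<bar> * \<epsilon> * exp (- \<epsilon> * x)) \<partial>lborel)"
    if [measurable]: "h \<in> borel_measurable borel" for h :: "real \<Rightarrow> ennreal"
  proof -
    \<comment> \<open>Three substitutions in turn: \<open>u = b * v\<close>,
      \<open>v = exp y\<close>, \<open>y = - \<epsilon> * x\<close>.\<close>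
    have "(\<integral>\<^sup>+u. h u * indicator {u. 0 < u / b} u \<partial>lborel) =
        ennreal \<bar>b\<bar> * (\<integral>\<^sup>+v. h (b * v) * indicator {0<..} v \<partial>lborel)"
      using \<open>b \<noteq> 0\<close>
      by (subst nn_integral_real_affine[where c = b and t = 0])
         (auto simp: indicator_def intro!: arg_cong[where f = "\<lambda>x. ennreal \<bar>b\<bar> * x"] nn_integral_cong)
    also have "(\<integral>\<^sup>+v. h (b * v) * indicator {0<..} v \<partial>lborel) =
        (\<integral>\<^sup>+y. h (b * exp y) * ennreal (exp y) \<partial>lborel)"
      by (rule nn_integral_exp_substitution) simp
    also have "\<dots> = ennreal \<epsilon> * (\<integral>\<^sup>+x. h (b * exp (- \<epsilon> * x)) * ennreal (exp (- \<epsilon> * x)) \<partial>lborel)"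
      using \<open>\<epsilon> > 0\<close> by (subst nn_integral_real_affine[where c = "- \<epsilon>" and t = 0]) auto
    also have "ennreal \<bar>b\<bar> * \<dots> =
        (\<integral>\<^sup>+x. h (b * exp (- \<epsilon> * x)) * (ennreal \<bar>b\<bar> * ennreal \<epsilon> * ennreal (exp (- \<epsilon> * x))) \<partial>lborel)"
      by (simp add: ac_simps flip: nn_integral_cmult)
    also have "\<dots> = (\<integral>\<^sup>+x. h (b * exp (- \<epsilon> * x)) * ennreal (\<bar>b\<bar> * \<epsilon> * exp (- \<epsilon> * x)) \<partial>lborel)"
      using \<open>\<epsilon> > 0\<close> by (simp add: ennreal_mult' ennreal_mult'')
    finally show ?thesis .
  qed
  show "{u. 0 < u / b} \<in> sets borel"
    by measurable
qed (use assms in auto)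

section \<open>Square-integrable functions and polarization\<close>

lemma L2_mult_cis:
  assumes "f \<in> L2" and "(\<lambda>x. \<theta> x) \<in> borel_measurable borel"
  shows "(\<lambda>x. cis (\<theta> x) * f x) \<in> L2"
proof -
  have "(\<lambda>x. cis (\<theta> x)) \<in> borel_measurable lebesgue"
    by (rule measurable_completion) (use assms(2) in measurable)
  then show ?thesis
    using assms(1) by (auto simp: L2_def norm_mult)
qed

lemma L2_translate:
  assumes "f \<in> L2"
  shows "(\<lambda>x. f (x + q)) \<in> L2"
proof -
  have "(\<lambda>x. x + q) \<in> lebesgue \<rightarrow>\<^sub>M lebesgue"
    using lebesgue_affine_measurable[of "\<lambda>_. 1" q] by (simp add: add.commute)
  moreover have "integrable lebesgue (\<lambda>x. (cmod (f (x + q)))\<^sup>2)"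
    using assms lebesgue_integrable_real_affine[of "\<lambda>x. (cmod (f x))\<^sup>2" 1 q]
    by (simp add: L2_def add.commute)
  ultimately show ?thesis
    using assms by (auto simp: L2_def intro: measurable_compose)
qed

lemma L2_add_mult:
  assumes f: "f \<in> L2" and g: "g \<in> L2"
  shows "(\<lambda>x. f x + z * g x) \<in> L2"
proof -
  have [measurable]: "f \<in> borel_measurable lebesgue" "g \<in> borel_measurable lebesgue"
    using f g by (auto simp: L2_def)
  have "integrable lebesgue (\<lambda>x. (cmod (f x + z * g x))\<^sup>2)"
  proof (rule Bochner_Integration.integrable_bound)
    show "integrable lebesgue (\<lambda>x. 2 * (cmod (f x))\<^sup>2 + 2 * (cmod z)\<^sup>2 * (cmod (g x))\<^sup>2)"
      using f g by (auto simp: L2_def)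
    have "(cmod (f x + z * g x))\<^sup>2 \<le> 2 * (cmod (f x))\<^sup>2 + 2 * (cmod z)\<^sup>2 * (cmod (g x))\<^sup>2" for x
    proof -
      have "(cmod (f x + z * g x))\<^sup>2 \<le> (cmod (f x) + cmod (z * g x))\<^sup>2"
        by (intro power_mono norm_triangle_ineq) simp
      also have "\<dots> \<le> 2 * (cmod (f x))\<^sup>2 + 2 * (cmod (z * g x))\<^sup>2"
        using sum_squares_bound[of "cmod (f x)" "cmod (z * g x)"] by (simp add: power2_sum)
      finally show ?thesis
        by (simp add: norm_mult power_mult_distrib)
    qed
    then show "AE x in lebesgue. norm ((cmod (f x + z * g x))\<^sup>2) \<le>
        norm (2 * (cmod (f x))\<^sup>2 + 2 * (cmod z)\<^sup>2 * (cmod (g x))\<^sup>2)"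
      by (auto intro: order.trans)
  qed simp
  then show ?thesis
    by (auto simp: L2_def)
qed

lemma integrable_L2_product:
  assumes f: "f \<in> L2" and g: "g \<in> L2"
  shows "integrable lebesgue (\<lambda>x. cnj (f x) * g x)"
proof (rule Bochner_Integration.integrable_bound)
  show "integrable lebesgue (\<lambda>x. (cmod (f x))\<^sup>2 + (cmod (g x))\<^sup>2)"
    using f g by (auto simp: L2_def)
  show "(\<lambda>x. cnj (f x) * g x) \<in> borel_measurable lebesgue"
    using f g by (auto simp: L2_def intro!: borel_measurable_times measurable_compose[OF _ measurable_cnj])
  show "AE x in lebesgue. norm (cnj (f x) * g x) \<le> norm ((cmod (f x))\<^sup>2 + (cmod (g x))\<^sup>2)"
  proof (rule AE_I2)
    fix x
    have "cmod (f x) * cmod (g x) \<le> (cmod (f x))\<^sup>2 + (cmod (g x))\<^sup>2"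
      using sum_squares_bound[of "cmod (f x)" "cmod (g x)"]
        mult_nonneg_nonneg[OF norm_ge_zero norm_ge_zero, of "f x" "g x"] by linarith
    then show "norm (cnj (f x) * g x) \<le> norm ((cmod (f x))\<^sup>2 + (cmod (g x))\<^sup>2)"
      by (simp add: norm_mult)
  qed
qed

lemma inner_L2_commute: "inner_L2 g f = cnj (inner_L2 f g)"
  unfolding inner_L2_def Bochner_Integration.integral_cnj[symmetric] by (simp add: mult.commute)

lemma inner_L2_conj_linear_left:
  assumes "f \<in> L2" "g \<in> L2" "h \<in> L2"
  shows "inner_L2 (\<lambda>x. f x + z * g x) h = inner_L2 f h + cnj z * inner_L2 g h"
proof -
  have "inner_L2 (\<lambda>x. f x + z * g x) h =
      (LINT x|lebesgue. cnj (f x) * h x + cnj z * (cnj (g x) * h x))"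
    unfolding inner_L2_def by (simp add: algebra_simps)
  also have "\<dots> = inner_L2 f h + cnj z * inner_L2 g h"
    using integrable_L2_product assms unfolding inner_L2_def
    by (subst Bochner_Integration.integral_add) auto
  finally show ?thesis .
qed

lemma norm_squared_add:
  fixes u v z :: complex
  shows "(cmod (u + z * v))\<^sup>2 = (cmod u)\<^sup>2 + (cmod z)\<^sup>2 * (cmod v)\<^sup>2 + 2 * Re (z * (cnj u * v))"
  unfolding cmod_power2 by (simp add: power2_eq_square algebra_simps)

lemma integral_norm_squared_add:
  assumes f: "f \<in> L2" and g: "g \<in> L2"
  shows "(LINT x|lebesgue. (cmod (f x + z * g x))\<^sup>2) =
    (LINT x|lebesgue. (cmod (f x))\<^sup>2) + (cmod z)\<^sup>2 * (LINT x|lebesgue. (cmod (g x))\<^sup>2) +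
    2 * Re (z * inner_L2 f g)"
proof -
  note i = integrable_L2_product[OF f g]
  have "(LINT x|lebesgue. Re (z * (cnj (f x) * g x))) = Re (z * inner_L2 f g)"
    unfolding inner_L2_def using i by (subst integral_Re) (auto intro: integrable_mult_right)
  moreover have "integrable lebesgue (\<lambda>x. Re (z * (cnj (f x) * g x)))"
    using i by (intro integrable_Re integrable_mult_right) auto
  moreover have "integrable lebesgue (\<lambda>x. (cmod (f x))\<^sup>2)" "integrable lebesgue (\<lambda>x. (cmod (g x))\<^sup>2)"
    using f g by (auto simp: L2_def)
  ultimately show ?thesis
    unfolding norm_squared_add
    by (simp only: Bochner_Integration.integral_add Bochner_Integration.integrable_add
      integrable_mult_right integral_mult_right_zero)
qed

text \<open>The norm identity is applied to \<open>f + z * g\<close> and both sides are expanded.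
  The diagonal terms agree by the identity for \<open>f\<close> and \<open>g\<close>, so the cross
  terms agree for every complex \<open>z\<close>.\<close>

lemma resolution_of_identity_polarization:
  fixes V :: "(real \<Rightarrow> complex) \<Rightarrow> 'a \<Rightarrow> complex" and W :: "'a \<Rightarrow> real"
  assumes V[measurable]: "\<And>f. f \<in> L2 \<Longrightarrow> V f \<in> borel_measurable M"
    and W[measurable]: "W \<in> borel_measurable M" and W0: "\<And>x. W x \<ge> 0"
    and add: "\<And>f g z x. f \<in> L2 \<Longrightarrow> g \<in> L2 \<Longrightarrow> V (\<lambda>t. f t + z * g t) x = V f x + cnj z * V g x"
    and norm: "\<And>f. f \<in> L2 \<Longrightarrow> (\<integral>\<^sup>+x. ennreal ((cmod (V f x))\<^sup>2 * W x) \<partial>M) =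
      ennreal (C * (LINT t|lebesgue. (cmod (f t))\<^sup>2))"
    and "C \<ge> 0" and f: "f \<in> L2" and g: "g \<in> L2"
  shows "integrable M (\<lambda>x. V f x * cnj (V g x) * complex_of_real (W x))"
    and "(LINT x|M. V f x * cnj (V g x) * complex_of_real (W x)) = complex_of_real C * inner_L2 f g"
proof -
  let ?N = "\<lambda>h. LINT t|lebesgue. (cmod (h t))\<^sup>2"
  have i: "integrable M (\<lambda>x. (cmod (V h x))\<^sup>2 * W x)" if h: "h \<in> L2" for h
  proof (rule integrableI_bounded)
    show "(\<lambda>x. (cmod (V h x))\<^sup>2 * W x) \<in> borel_measurable M"
      using V[OF h] by measurable
    show "(\<integral>\<^sup>+x. ennreal (norm ((cmod (V h x))\<^sup>2 * W x)) \<partial>M) < \<infinity>"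
      using norm[OF h] W0 by simp
  qed
  have I: "(LINT x|M. (cmod (V h x))\<^sup>2 * W x) = C * ?N h" if h: "h \<in> L2" for h
    using norm[OF h] i[OF h] W0 \<open>C \<ge> 0\<close> by (simp add: nn_integral_eq_integral)
  let ?P = "\<lambda>x. V f x * cnj (V g x) * complex_of_real (W x)"
  show P: "integrable M ?P"
  proof (rule Bochner_Integration.integrable_bound)
    show "integrable M (\<lambda>x. (cmod (V f x))\<^sup>2 * W x + (cmod (V g x))\<^sup>2 * W x)"
      using i[OF f] i[OF g] by simp
    show "?P \<in> borel_measurable M"
      using V[OF f] V[OF g] by measurable
    show "AE x in M. cmod (?P x) \<le> norm ((cmod (V f x))\<^sup>2 * W x + (cmod (V g x))\<^sup>2 * W x)"
    proof (rule AE_I2)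
      fix x
      have "cmod (V f x) * cmod (V g x) \<le> (cmod (V f x))\<^sup>2 + (cmod (V g x))\<^sup>2"
        using sum_squares_bound[of "cmod (V f x)" "cmod (V g x)"]
          mult_nonneg_nonneg[OF norm_ge_zero norm_ge_zero, of "V f x" "V g x"] by linarith
      from mult_right_mono[OF this W0[of x]]
      show "cmod (?P x) \<le> norm ((cmod (V f x))\<^sup>2 * W x + (cmod (V g x))\<^sup>2 * W x)"
        using W0[of x] by (simp add: norm_mult distrib_right)
    qed
  qed
  have re: "Re (z * integral\<^sup>L M ?P) = Re (z * (C * inner_L2 f g))" for z
  proof -
    have fg: "(\<lambda>t. f t + z * g t) \<in> L2"
      by (rule L2_add_mult[OF f g])
    have "(LINT x|M. (cmod (V (\<lambda>t. f t + z * g t) x))\<^sup>2 * W x) =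
        (LINT x|M. (cmod (V f x))\<^sup>2 * W x + (cmod z)\<^sup>2 * ((cmod (V g x))\<^sup>2 * W x) + 2 * Re (z * ?P x))"
    proof (rule Bochner_Integration.integral_cong[OF refl])
      fix x
      have "(cmod (V f x + cnj z * V g x))\<^sup>2 = (cmod (V f x))\<^sup>2 + (cmod z)\<^sup>2 * (cmod (V g x))\<^sup>2 +
          2 * Re (z * (V f x * cnj (V g x)))"
        unfolding norm_squared_add by (simp add: algebra_simps)
      moreover have "Re (z * ?P x) = Re (z * (V f x * cnj (V g x))) * W x"
        by (simp only: mult.assoc[symmetric] Re_complex_of_real times_complex.sel Im_complex_of_real)
      ultimately show "(cmod (V (\<lambda>t. f t + z * g t) x))\<^sup>2 * W x =
          (cmod (V f x))\<^sup>2 * W x + (cmod z)\<^sup>2 * ((cmod (V g x))\<^sup>2 * W x) + 2 * Re (z * ?P x)"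
        unfolding add[OF f g] by (simp only: distrib_right mult.assoc)
    qed
    also have "\<dots> = C * ?N f + (cmod z)\<^sup>2 * (C * ?N g) + 2 * (LINT x|M. Re (z * ?P x))"
    proof -
      have "integrable M (\<lambda>x. Re (z * ?P x))"
        by (intro integrable_Re integrable_mult_right P)
      then show ?thesis
        using i[OF f] i[OF g] by (simp only: Bochner_Integration.integral_add I[OF f] I[OF g]
          Bochner_Integration.integrable_add integrable_mult_right integral_mult_right_zero)
    qed
    also have "(LINT x|M. Re (z * ?P x)) = Re (z * integral\<^sup>L M ?P)"
      using P by (subst integral_Re) (auto intro: integrable_mult_right)
    finally show ?thesis
      unfolding I[OF fg] integral_norm_squared_add[OF f g] by (simp add: algebra_simps)
  qed
  \<comment> \<open>\<open>z = 1\<close> compares real parts; \<open>z = - \<i>\<close> compares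
    imaginary parts.\<close>
  show "integral\<^sup>L M ?P = complex_of_real C * inner_L2 f g"
    using re[of 1] re[of "- \<i>"] by (simp add: complex_eq_iff)
qed

section \<open>Null sets and Borel representatives\<close>

lemma AE_lebesgue_translate:
  fixes q :: real
  assumes "AE x in lebesgue. P x"
  shows "AE x in lebesgue. P (x + q)"
proof -
  obtain N where N: "negligible N" "{x. \<not> P x} \<subseteq> N"
    using assms unfolding eventually_ae_filter_negligible by blast
  have "negligible ((+) (- q) ` N)"
    by (rule negligible_translation[OF N(1)])
  moreover have "{x. \<not> P (x + q)} \<subseteq> (+) (- q) ` N"
  proof
    fix x assume "x \<in> {x. \<not> P (x + q)}"
    then have "x + q \<in> N"
      using N(2) by auto
    then show "x \<in> (+) (- q) ` N"
      by (rule rev_image_eqI) simp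
  qed
  ultimately show ?thesis
    unfolding eventually_ae_filter_negligible by blast
qed

text \<open>Tonelli's theorem on the product of Borel spaces needs joint measurability in
  \<open>x\<close> and \<open>q\<close>. A Borel function composed with \<open>x + q\<close> has it;
  a merely Lebesgue measurable one need not.\<close>

lemma L2_borel_representative:
  assumes "f \<in> L2"
  obtains f' where "f' \<in> borel_measurable borel" and "f' \<in> L2" and "AE x in lebesgue. f x = f' x"
proof -
  have f: "f \<in> borel_measurable lebesgue"
    using assms by (simp add: L2_def)
  have "(\<lambda>x. Re (f x)) \<in> borel_measurable lebesgue" "(\<lambda>x. Im (f x)) \<in> borel_measurable lebesgue"
    using f by measurable
  then obtain r i where [measurable]: "r \<in> borel_measurable borel" "i \<in> borel_measurable borel"
    and r: "AE x in lborel. Re (f x) = r x" and i: "AE x in lborel. Im (f x) = i x"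
    using completion_ex_borel_measurable_real[of "\<lambda>x. Re (f x)" lborel]
      completion_ex_borel_measurable_real[of "\<lambda>x. Im (f x)" lborel] by auto
  define f' where "f' x = complex_of_real (r x) + \<i> * complex_of_real (i x)" for x
  have f': "f' \<in> borel_measurable borel"
    unfolding f'_def by measurable
  have ae: "AE x in lebesgue. f x = f' x"
    using r[THEN AE_completion] i[THEN AE_completion]
    by eventually_elim (simp add: f'_def complex_eq_iff)
  have f'm: "f' \<in> borel_measurable lebesgue"
    by (rule measurable_completion) (use f' in simp)
  have "integrable lebesgue (\<lambda>x. (cmod (f' x))\<^sup>2)"
    by (rule integrable_cong_AE_imp[of lebesgue "\<lambda>x. (cmod (f x))\<^sup>2"])
       (use assms f'm ae in \<open>auto simp: L2_def\<close>)
  then show ?thesis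
    using that f' f'm ae by (auto simp: L2_def)
qed

section \<open>Integrals of squared overlaps\<close>

lemma inner_L2_phase_translate:
  assumes "f \<in> L2" "f' \<in> L2" "\<psi> \<in> L2" "\<psi>' \<in> L2"
    and [measurable]: "f' \<in> borel_measurable borel" "\<psi>' \<in> borel_measurable borel" "u \<in> borel_measurable borel"
    and "AE x in lebesgue. f x = f' x" "AE x in lebesgue. \<psi> x = \<psi>' x"
  shows "inner_L2 f (\<lambda>x. cis (u x) * \<psi> (x + q)) = (LBINT x. cnj (f' x) * (cis (u x) * \<psi>' (x + q)))"
proof -
  have "inner_L2 f (\<lambda>x. cis (u x) * \<psi> (x + q)) = inner_L2 f' (\<lambda>x. cis (u x) * \<psi>' (x + q))"
    unfolding inner_L2_def
  proof (rule integral_cong_AE)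
    show "AE x in lebesgue. cnj (f x) * (cis (u x) * \<psi> (x + q)) = cnj (f' x) * (cis (u x) * \<psi>' (x + q))"
      using assms(8) AE_lebesgue_translate[OF assms(9), of q] by eventually_elim simp
    show "(\<lambda>x. cnj (f x) * (cis (u x) * \<psi> (x + q))) \<in> borel_measurable lebesgue"
      by (intro borel_measurable_integrable integrable_L2_product L2_mult_cis L2_translate assms)
    show "(\<lambda>x. cnj (f' x) * (cis (u x) * \<psi>' (x + q))) \<in> borel_measurable lebesgue"
      by (intro borel_measurable_integrable integrable_L2_product L2_mult_cis L2_translate assms)
  qed
  then show ?thesis
    unfolding inner_L2_def by (subst (asm) (2) integral_completion) auto
qed

text \<open>\<open>\<kappa> q\<close> is the density that Plancherel's theorem produces for the phase \<open>s q\<close>; the weight \<open>W\<close> must turn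
  it into a function of \<open>x + q\<close> so that the double integral factorizes.\<close>

lemma
  fixes \<phi> :: "real \<Rightarrow> real \<Rightarrow> real \<Rightarrow> complex" and \<theta> s \<kappa> :: "real \<Rightarrow> real \<Rightarrow> real"
  assumes f: "f \<in> L2" and \<psi>: "\<psi> \<in> L2"
    and \<phi>: "\<And>q p x. \<phi> q p x = cis (\<theta> q p + p * s q x) * \<psi> (x + q)"
    and \<theta>: "case_prod \<theta> \<in> borel_measurable (borel \<Otimes>\<^sub>M borel)"
    and s: "case_prod s \<in> borel_measurable (borel \<Otimes>\<^sub>M borel)"
    and [measurable]: "W \<in> borel_measurable borel" and W0: "\<And>q. W q \<ge> 0"
    and [measurable]: "K \<in> borel_measurable borel" and K0: "\<And>y. K y \<ge> 0"
    and plancherel: "\<And>q \<Phi>. integrable lborel \<Phi> \<Longrightarrow>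
      (\<integral>\<^sup>+p. ennreal ((norm (LBINT x. \<Phi> x * cis (p * s q x)))\<^sup>2) \<partial>lborel) =
      (\<integral>\<^sup>+x. ennreal (\<kappa> q x * (norm (\<Phi> x))\<^sup>2) \<partial>lborel)"
    and \<kappa>0: "\<And>q x. \<kappa> q x \<ge> 0" and W\<kappa>: "\<And>q x. W q * \<kappa> q x = K (x + q)"
  shows measurable_coherent_overlap:
      "(\<lambda>(q, p). inner_L2 f (\<phi> q p)) \<in> borel_measurable lebesgue"
    and nn_integral_coherent_overlap:
      "(\<integral>\<^sup>+(q, p). ennreal ((cmod (inner_L2 f (\<phi> q p)))\<^sup>2 * W q) \<partial>lebesgue) =
      (\<integral>\<^sup>+x. ennreal ((cmod (f x))\<^sup>2) \<partial>lebesgue) * (\<integral>\<^sup>+y. ennreal (K y * (cmod (\<psi> y))\<^sup>2) \<partial>lebesgue)"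
proof -
  obtain f' where [measurable]: "f' \<in> borel_measurable borel" and f': "f' \<in> L2"
    and ff': "AE x in lebesgue. f x = f' x"
    using L2_borel_representative[OF f] .
  obtain \<psi>' where [measurable]: "\<psi>' \<in> borel_measurable borel" and \<psi>': "\<psi>' \<in> L2"
    and \<psi>\<psi>': "AE x in lebesgue. \<psi> x = \<psi>' x"
    using L2_borel_representative[OF \<psi>] .
  have [measurable (raw)]: "(\<lambda>x. \<theta> (g x) (h x)) \<in> borel_measurable N"
    if "g \<in> borel_measurable N" "h \<in> borel_measurable N" for g h and N :: "'c measure"
    using measurable_compose[OF measurable_Pair[OF that] \<theta>] by simp
  have [measurable (raw)]: "(\<lambda>x. s (g x) (h x)) \<in> borel_measurable N"
    if "g \<in> borel_measurable N" "h \<in> borel_measurable N" for g h and N :: "'c measure"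
    using measurable_compose[OF measurable_Pair[OF that] s] by simp
  define \<Phi> where "\<Phi> q x = cnj (f' x) * \<psi>' (x + q)" for q x
  have \<Phi>_int: "integrable lborel (\<Phi> q)" for q
    unfolding \<Phi>_def using integrable_L2_product[OF f' L2_translate[OF \<psi>', of q]]
    by (subst (asm) integrable_completion) auto
  have [measurable (raw)]: "(\<lambda>x. \<Phi> (g x) (h x)) \<in> borel_measurable N"
    if "g \<in> borel_measurable N" "h \<in> borel_measurable N" for g h and N :: "'c measure"
    unfolding \<Phi>_def using that by measurable
  define v where "v q p = (LBINT x. \<Phi> q x * cis (p * s q x))" for q p
  \<comment> \<open>The phase \<open>\<theta> q p\<close> does not depend on \<open>x\<close>, so it
    leaves the integral and disappears in the modulus.\<close>
  have V: "inner_L2 f (\<phi> q p) = cis (\<theta> q p) * v q p" for q p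
  proof -
    have "\<phi> q p = (\<lambda>x. cis (\<theta> q p + p * s q x) * \<psi> (x + q))"
      by (simp add: fun_eq_iff \<phi>)
    then have "inner_L2 f (\<phi> q p) = inner_L2 f (\<lambda>x. cis (\<theta> q p + p * s q x) * \<psi> (x + q))"
      by simp
    also have "\<dots> = (LBINT x. cnj (f' x) * (cis (\<theta> q p + p * s q x) * \<psi>' (x + q)))"
      by (rule inner_L2_phase_translate) (use f f' \<psi> \<psi>' ff' \<psi>\<psi>' in simp_all)
    also have "\<dots> = cis (\<theta> q p) * v q p"
      unfolding v_def by (simp add: \<Phi>_def ac_simps flip: cis_mult integral_mult_right_zero)
    finally show ?thesis .
  qed
  have v[measurable]: "(\<lambda>(q, p). v q p) \<in> borel_measurable (borel \<Otimes>\<^sub>M borel)"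
    unfolding v_def by measurable
  have "(\<lambda>(q, p). inner_L2 f (\<phi> q p)) \<in> borel_measurable (borel \<Otimes>\<^sub>M borel)"
    unfolding V by measurable
  then show "(\<lambda>(q, p). inner_L2 f (\<phi> q p)) \<in> borel_measurable lebesgue"
    by (intro measurable_completion) (simp add: borel_prod)
  have "(\<integral>\<^sup>+(q, p). ennreal ((cmod (inner_L2 f (\<phi> q p)))\<^sup>2 * W q) \<partial>lebesgue) =
      (\<integral>\<^sup>+(q, p). ennreal ((cmod (v q p))\<^sup>2 * W q) \<partial>(lborel \<Otimes>\<^sub>M lborel))"
    unfolding nn_integral_completion lborel_prod V by (simp add: norm_mult)
  also have "\<dots> = (\<integral>\<^sup>+q. \<integral>\<^sup>+p. ennreal ((cmod (v q p))\<^sup>2 * W q) \<partial>lborel \<partial>lborel)"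
    by (subst lborel.nn_integral_fst[symmetric]) simp_all
  also have "\<dots> = (\<integral>\<^sup>+q. \<integral>\<^sup>+x. ennreal ((cmod (f' x))\<^sup>2) * ennreal (K (x + q) * (cmod (\<psi>' (x + q)))\<^sup>2) \<partial>lborel \<partial>lborel)"
  proof (rule nn_integral_cong)
    fix q
    have [measurable]: "(\<lambda>p. v q p) \<in> borel_measurable borel"
      using measurable_compose[OF measurable_Pair1'[of q borel borel] v] by simp
    have "(\<integral>\<^sup>+p. ennreal ((cmod (v q p))\<^sup>2 * W q) \<partial>lborel) = ennreal (W q) * (\<integral>\<^sup>+p. ennreal ((cmod (v q p))\<^sup>2) \<partial>lborel)"
      using W0[of q] by (subst nn_integral_cmult[symmetric]) (auto simp: mult.commute simp flip: ennreal_mult)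
    also have "\<dots> = ennreal (W q) * (\<integral>\<^sup>+x. ennreal (\<kappa> q x * (norm (\<Phi> q x))\<^sup>2) \<partial>lborel)"
      unfolding v_def plancherel[OF \<Phi>_int] ..
    also have "\<dots> = (\<integral>\<^sup>+x. ennreal ((cmod (f' x))\<^sup>2) * ennreal (K (x + q) * (cmod (\<psi>' (x + q)))\<^sup>2) \<partial>lborel)"
    \<comment> \<open>The case split supplies measurability of \<open>\<kappa> q\<close>: for
      nonzero \<open>W q\<close> it equals \<open>K (x + q) / W q\<close>, and for
      \<open>W q = 0\<close> both sides vanish.\<close>
    proof (cases "W q = 0")
      case True
      then have "K (x + q) = 0" for x
        using W\<kappa>[of q x] by simp
      then show ?thesis
        using True by simp
    next
      case False
      have "(\<lambda>x. \<kappa> q x) = (\<lambda>x. K (x + q) / W q)"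
        using False by (simp add: W\<kappa>[symmetric] fun_eq_iff)
      then have "(\<lambda>x. \<kappa> q x) \<in> borel_measurable borel"
        by simp
      then have "ennreal (W q) * (\<integral>\<^sup>+x. ennreal (\<kappa> q x * (norm (\<Phi> q x))\<^sup>2) \<partial>lborel) =
          (\<integral>\<^sup>+x. ennreal (W q) * ennreal (\<kappa> q x * (norm (\<Phi> q x))\<^sup>2) \<partial>lborel)"
        by (subst nn_integral_cmult) auto
      also have "\<dots> = (\<integral>\<^sup>+x. ennreal ((cmod (f' x))\<^sup>2) * ennreal (K (x + q) * (cmod (\<psi>' (x + q)))\<^sup>2) \<partial>lborel)"
      proof (rule nn_integral_cong)
        fix x
        have "W q * (\<kappa> q x * (norm (\<Phi> q x))\<^sup>2) = (cmod (f' x))\<^sup>2 * (K (x + q) * (cmod (\<psi>' (x + q)))\<^sup>2)"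
          by (simp add: W\<kappa>[symmetric] \<Phi>_def norm_mult power_mult_distrib)
        then show "ennreal (W q) * ennreal (\<kappa> q x * (norm (\<Phi> q x))\<^sup>2) =
            ennreal ((cmod (f' x))\<^sup>2) * ennreal (K (x + q) * (cmod (\<psi>' (x + q)))\<^sup>2)"
          using W0[of q] \<kappa>0[of q x] K0[of "x + q"] by (simp flip: ennreal_mult)
      qed
      finally show ?thesis .
    qed
    finally show "(\<integral>\<^sup>+p. ennreal ((cmod (v q p))\<^sup>2 * W q) \<partial>lborel) =
        (\<integral>\<^sup>+x. ennreal ((cmod (f' x))\<^sup>2) * ennreal (K (x + q) * (cmod (\<psi>' (x + q)))\<^sup>2) \<partial>lborel)" .
  qed
  \<comment> \<open>With \<open>q\<close> integrated first, the shift \<open>y = x + q\<close> makes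
    the inner integral independent of \<open>x\<close>, and the product splits.\<close>
  also have "\<dots> = (\<integral>\<^sup>+x. \<integral>\<^sup>+q. ennreal ((cmod (f' x))\<^sup>2) * ennreal (K (x + q) * (cmod (\<psi>' (x + q)))\<^sup>2) \<partial>lborel \<partial>lborel)"
    by (rule lborel_pair.Fubini') measurable
  also have "\<dots> = (\<integral>\<^sup>+x. ennreal ((cmod (f' x))\<^sup>2) * (\<integral>\<^sup>+y. ennreal (K y * (cmod (\<psi>' y))\<^sup>2) \<partial>lborel) \<partial>lborel)"
  proof (rule nn_integral_cong)
    fix x
    have "(\<integral>\<^sup>+y. ennreal (K y * (cmod (\<psi>' y))\<^sup>2) \<partial>lborel) =
        (\<integral>\<^sup>+q. ennreal (K (x + q) * (cmod (\<psi>' (x + q)))\<^sup>2) \<partial>lborel)"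
      by (subst nn_integral_real_affine[where c = 1 and t = x]) auto
    then show "(\<integral>\<^sup>+q. ennreal ((cmod (f' x))\<^sup>2) * ennreal (K (x + q) * (cmod (\<psi>' (x + q)))\<^sup>2) \<partial>lborel) =
        ennreal ((cmod (f' x))\<^sup>2) * (\<integral>\<^sup>+y. ennreal (K y * (cmod (\<psi>' y))\<^sup>2) \<partial>lborel)"
      by (simp add: nn_integral_cmult)
  qed
  also have "\<dots> = (\<integral>\<^sup>+x. ennreal ((cmod (f' x))\<^sup>2) \<partial>lborel) * (\<integral>\<^sup>+y. ennreal (K y * (cmod (\<psi>' y))\<^sup>2) \<partial>lborel)"
    by (rule nn_integral_multc) simp
  also have "(\<integral>\<^sup>+x. ennreal ((cmod (f' x))\<^sup>2) \<partial>lborel) = (\<integral>\<^sup>+x. ennreal ((cmod (f x))\<^sup>2) \<partial>lebesgue)"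
    unfolding nn_integral_completion[of lborel, symmetric]
    by (rule nn_integral_cong_AE) (use ff' in eventually_elim, simp)
  also have "(\<integral>\<^sup>+y. ennreal (K y * (cmod (\<psi>' y))\<^sup>2) \<partial>lborel) = (\<integral>\<^sup>+y. ennreal (K y * (cmod (\<psi> y))\<^sup>2) \<partial>lebesgue)"
    unfolding nn_integral_completion[of lborel, symmetric]
    by (rule nn_integral_cong_AE) (use \<psi>\<psi>' in eventually_elim, simp)
  finally show "(\<integral>\<^sup>+(q, p). ennreal ((cmod (inner_L2 f (\<phi> q p)))\<^sup>2 * W q) \<partial>lebesgue) =
      (\<integral>\<^sup>+x. ennreal ((cmod (f x))\<^sup>2) \<partial>lebesgue) * (\<integral>\<^sup>+y. ennreal (K y * (cmod (\<psi> y))\<^sup>2) \<partial>lebesgue)" .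
qed

section \<open>Phases and overlaps of the two coherent-state families\<close>

lemma weight_pos: "\<epsilon> > 0 \<Longrightarrow> weight \<epsilon> q > 0"
  unfolding weight_def by (auto simp: zero_less_divide_iff zero_less_mult_iff mult_less_0_iff)

text \<open>The Plancherel density has \<open>weight \<epsilon> (- q)\<close> in its denominator;
  multiplied by \<open>weight \<epsilon> q\<close> it leaves only
  \<open>exp (\<epsilon> * q)\<close>.\<close>

lemma weight_eq_exp_mult: "\<epsilon> \<noteq> 0 \<Longrightarrow> weight \<epsilon> q = exp (\<epsilon> * q) * weight \<epsilon> (- q)"
  by (auto simp: weight_def field_simps simp flip: exp_add)

lemma measurable_weight [measurable]: "weight \<epsilon> \<in> borel_measurable borel"
  unfolding weight_def by measurable

text \<open>On the section \<open>(q, q * p / 2, p)\<close> the term of \<open>P_map\<close> with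
  factor \<open>\<epsilon>\<close> cancels, so the third component is \<open>p\<close>; the dilation
  by \<open>exp (- \<epsilon> * q)\<close> becomes translation by \<open>q\<close>. The parameter
  \<open>a\<close> enters only through a phase free of \<open>x\<close>.\<close>

lemma ea_coherent_phase:
  assumes "\<epsilon> \<noteq> 0"
  shows "ea_coherent \<epsilon> a b \<psi> q p x = cis (a * p + p * (b * weight \<epsilon> (- q) * exp (- \<epsilon> * x))) * \<psi> (x + q)"
proof -
  have "(if q = 0 then 1 else (exp (- \<epsilon> * q) - 1) / (- \<epsilon> * q)) = weight \<epsilon> (- q)"
    by (simp add: weight_def)
  then show ?thesis
    using assms by (simp add: ea_coherent_def rho_tilde_def cis_mult ac_simps)
qed

lemma heis_coherent_phase:
  "heis_coherent A B \<psi> q p x = cis (A * (q * p / 2) + B * p + p * (A * x)) * \<psi> (x + q)"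
  by (simp add: heis_coherent_def sigma_H_def algebra_simps)

lemma
  assumes f: "f \<in> L2" and \<psi>: "\<psi> \<in> L2" and "b \<noteq> 0" and "\<epsilon> > 0"
  shows measurable_ea_overlap:
      "(\<lambda>(q, p). inner_L2 f (ea_coherent \<epsilon> a b \<psi> q p)) \<in> borel_measurable lebesgue"
    and nn_integral_ea_overlap:
      "(\<integral>\<^sup>+(q, p). ennreal ((cmod (inner_L2 f (ea_coherent \<epsilon> a b \<psi> q p)))\<^sup>2 * weight \<epsilon> q) \<partial>lebesgue) =
      (\<integral>\<^sup>+x. ennreal ((cmod (f x))\<^sup>2) \<partial>lebesgue) *
      (\<integral>\<^sup>+y. ennreal (2 * pi / (\<bar>b\<bar> * \<epsilon>) * exp (\<epsilon> * y) * (cmod (\<psi> y))\<^sup>2) \<partial>lebesgue)"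
proof -
  have w: "weight \<epsilon> q > 0" for q
    using weight_pos[OF \<open>\<epsilon> > 0\<close>] .
  have s: "(\<lambda>(q, x). b * weight \<epsilon> (- q) * exp (- \<epsilon> * x)) \<in> borel_measurable (borel \<Otimes>\<^sub>M borel)"
    and \<theta>: "(\<lambda>(q, p). a * p) \<in> borel_measurable (borel \<Otimes>\<^sub>M borel)"
    and K: "(\<lambda>y. 2 * pi / (\<bar>b\<bar> * \<epsilon>) * exp (\<epsilon> * y)) \<in> borel_measurable borel"
    by measurable
  have plancherel: "(\<integral>\<^sup>+p. ennreal ((norm (LBINT x. \<Phi> x * cis (p * (b * weight \<epsilon> (- q) * exp (- \<epsilon> * x)))))\<^sup>2) \<partial>lborel) =
      (\<integral>\<^sup>+x. ennreal (2 * pi / (\<bar>b * weight \<epsilon> (- q)\<bar> * \<epsilon> * exp (- \<epsilon> * x)) * (norm (\<Phi> x))\<^sup>2) \<partial>lborel)"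
    if "integrable lborel \<Phi>" for q and \<Phi> :: "real \<Rightarrow> complex"
    using w[of "- q"] \<open>b \<noteq> 0\<close> \<open>\<epsilon> > 0\<close> that by (intro nn_integral_exponential_phase) auto
  \<comment> \<open>The factors \<open>exp (\<epsilon> * q)\<close> from the weights and
    \<open>exp (\<epsilon> * x)\<close> from the Jacobian merge into a function of
    \<open>x + q\<close>.\<close>
  have W: "weight \<epsilon> q * (2 * pi / (\<bar>b * weight \<epsilon> (- q)\<bar> * \<epsilon> * exp (- \<epsilon> * x))) =
      2 * pi / (\<bar>b\<bar> * \<epsilon>) * exp (\<epsilon> * (x + q))" for q x
    using w[of "- q"] \<open>b \<noteq> 0\<close> \<open>\<epsilon> > 0\<close>
    by (subst weight_eq_exp_mult) (auto simp: abs_mult exp_minus exp_add distrib_left field_simps)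
  have phase: "ea_coherent \<epsilon> a b \<psi> q p x = cis (a * p + p * (b * weight \<epsilon> (- q) * exp (- \<epsilon> * x))) * \<psi> (x + q)"
    for q p x
    using \<open>\<epsilon> > 0\<close> by (intro ea_coherent_phase) simp
  have K0: "0 \<le> 2 * pi / (\<bar>b\<bar> * \<epsilon>) * exp (\<epsilon> * y)" for y
    using \<open>\<epsilon> > 0\<close> by simp
  have \<kappa>0: "0 \<le> 2 * pi / (\<bar>b * weight \<epsilon> (- q)\<bar> * \<epsilon> * exp (- \<epsilon> * x))" for q x
    using \<open>\<epsilon> > 0\<close> by simp
  note overlap = measurable_coherent_overlap nn_integral_coherent_overlap
  note overlap' = overlap[where f = f and \<psi> = \<psi> and \<phi> = "ea_coherent \<epsilon> a b \<psi>"
      and \<theta> = "\<lambda>q p. a * p" and s = "\<lambda>q x. b * weight \<epsilon> (- q) * exp (- \<epsilon> * x)"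
      and W = "weight \<epsilon>" and K = "\<lambda>y. 2 * pi / (\<bar>b\<bar> * \<epsilon>) * exp (\<epsilon> * y)"
      and \<kappa> = "\<lambda>q x. 2 * pi / (\<bar>b * weight \<epsilon> (- q)\<bar> * \<epsilon> * exp (- \<epsilon> * x))",
      OF f \<psi> phase \<theta> s measurable_weight less_imp_le[OF w] K K0 plancherel \<kappa>0 W]
  show "(\<lambda>(q, p). inner_L2 f (ea_coherent \<epsilon> a b \<psi> q p)) \<in> borel_measurable lebesgue"
    by (rule overlap'(1))
  show "(\<integral>\<^sup>+(q, p). ennreal ((cmod (inner_L2 f (ea_coherent \<epsilon> a b \<psi> q p)))\<^sup>2 * weight \<epsilon> q) \<partial>lebesgue) =
      (\<integral>\<^sup>+x. ennreal ((cmod (f x))\<^sup>2) \<partial>lebesgue) *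
      (\<integral>\<^sup>+y. ennreal (2 * pi / (\<bar>b\<bar> * \<epsilon>) * exp (\<epsilon> * y) * (cmod (\<psi> y))\<^sup>2) \<partial>lebesgue)"
    by (rule overlap'(2))
qed

text \<open>A linear phase has constant Jacobian, so the constant weight 1 already suits the general
  overlap formula; the factor \<open>* 1\<close> displays that weight.\<close>

lemma
  assumes f: "f \<in> L2" and \<psi>: "\<psi> \<in> L2" and "A \<noteq> 0"
  shows measurable_heis_overlap:
      "(\<lambda>(q, p). inner_L2 f (heis_coherent A B \<psi> q p)) \<in> borel_measurable lebesgue"
    and nn_integral_heis_overlap:
      "(\<integral>\<^sup>+(q, p). ennreal ((cmod (inner_L2 f (heis_coherent A B \<psi> q p)))\<^sup>2 * 1) \<partial>lebesgue) =
      (\<integral>\<^sup>+x. ennreal ((cmod (f x))\<^sup>2) \<partial>lebesgue) *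
      (\<integral>\<^sup>+y. ennreal (2 * pi / \<bar>A\<bar> * (cmod (\<psi> y))\<^sup>2) \<partial>lebesgue)"
proof -
  have s: "(\<lambda>(q, x). A * x) \<in> borel_measurable (borel \<Otimes>\<^sub>M borel)"
    and \<theta>: "(\<lambda>(q, p). A * (q * p / 2) + B * p) \<in> borel_measurable (borel \<Otimes>\<^sub>M borel)"
    by measurable
  have K0: "0 \<le> 2 * pi / \<bar>A\<bar>"
    by simp
  note overlap = measurable_coherent_overlap nn_integral_coherent_overlap
  note overlap' = overlap[where f = f and \<psi> = \<psi> and \<phi> = "heis_coherent A B \<psi>"
      and \<theta> = "\<lambda>q p. A * (q * p / 2) + B * p" and s = "\<lambda>q x. A * x"
      and W = "\<lambda>q. 1" and K = "\<lambda>y. 2 * pi / \<bar>A\<bar>" and \<kappa> = "\<lambda>q x. 2 * pi / \<bar>A\<bar>",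
      OF f \<psi> heis_coherent_phase \<theta> s borel_measurable_const zero_le_one borel_measurable_const
        K0 nn_integral_linear_phase[OF \<open>A \<noteq> 0\<close>] K0 mult_1]
  show "(\<lambda>(q, p). inner_L2 f (heis_coherent A B \<psi> q p)) \<in> borel_measurable lebesgue"
    by (rule overlap'(1))
  show "(\<integral>\<^sup>+(q, p). ennreal ((cmod (inner_L2 f (heis_coherent A B \<psi> q p)))\<^sup>2 * 1) \<partial>lebesgue) =
      (\<integral>\<^sup>+x. ennreal ((cmod (f x))\<^sup>2) \<partial>lebesgue) *
      (\<integral>\<^sup>+y. ennreal (2 * pi / \<bar>A\<bar> * (cmod (\<psi> y))\<^sup>2) \<partial>lebesgue)"
    by (rule overlap'(2))
qed

section \<open>Resolutions of the identity\<close>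

lemma nn_integral_norm_squared_L2:
  "f \<in> L2 \<Longrightarrow> (\<integral>\<^sup>+x. ennreal ((cmod (f x))\<^sup>2) \<partial>lebesgue) = ennreal (LINT x|lebesgue. (cmod (f x))\<^sup>2)"
  by (intro nn_integral_eq_integral) (auto simp: L2_def)

text \<open>The overlap formula is a norm identity whose constant is finite by \<open>e\<close>;
  polarization turns it into the sesquilinear one.\<close>

lemma
  assumes \<psi>: "\<psi> \<in> L2" and "b \<noteq> 0" and "\<epsilon> > 0" and f: "f \<in> L2" and g: "g \<in> L2"
    and e: "integrable lebesgue (\<lambda>y. exp (\<epsilon> * y) * (cmod (\<psi> y))\<^sup>2)"
  shows integrable_ea_integrand: "integrable lebesgue (ea_integrand \<epsilon> a b \<psi> f g)"
    and integral_ea_integrand: "integral\<^sup>L lebesgue (ea_integrand \<epsilon> a b \<psi> f g) =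
      complex_of_real (2 * pi / (\<bar>b\<bar> * \<epsilon>) * (LINT y|lebesgue. exp (\<epsilon> * y) * (cmod (\<psi> y))\<^sup>2)) * inner_L2 f g"
proof -
  let ?C = "2 * pi / (\<bar>b\<bar> * \<epsilon>) * (LINT y|lebesgue. exp (\<epsilon> * y) * (cmod (\<psi> y))\<^sup>2)"
  let ?V = "\<lambda>f (q, p). inner_L2 f (ea_coherent \<epsilon> a b \<psi> q p)"
  let ?W = "\<lambda>(q, p :: real). weight \<epsilon> q"
  have C: "?C \<ge> 0"
    using \<open>\<epsilon> > 0\<close> by (intro mult_nonneg_nonneg integral_nonneg_AE) auto
  have V: "?V h \<in> borel_measurable lebesgue" if "h \<in> L2" for h
    using measurable_ea_overlap[OF that \<psi> \<open>b \<noteq> 0\<close> \<open>\<epsilon> > 0\<close>] .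
  have W: "?W \<in> borel_measurable lebesgue"
    by (rule measurable_completion) (simp flip: borel_prod)
  have W0: "?W x \<ge> 0" for x
    using weight_pos[OF \<open>\<epsilon> > 0\<close>] by (auto simp: less_imp_le split: prod.split)
  have coh: "ea_coherent \<epsilon> a b \<psi> q p \<in> L2" for q p
  proof -
    have "ea_coherent \<epsilon> a b \<psi> q p =
        (\<lambda>x. cis (a * p + p * (b * weight \<epsilon> (- q) * exp (- \<epsilon> * x))) * \<psi> (x + q))"
      using \<open>\<epsilon> > 0\<close> by (intro ext ea_coherent_phase) simp
    also have "\<dots> \<in> L2"
      by (intro L2_mult_cis L2_translate \<psi>) measurable
    finally show ?thesis .
  qed
  have add: "?V (\<lambda>t. h t + z * k t) x = ?V h x + cnj z * ?V k x" if "h \<in> L2" "k \<in> L2" for h k z x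
    using inner_L2_conj_linear_left[OF that coh] by (auto split: prod.split)
  have norm: "(\<integral>\<^sup>+x. ennreal ((cmod (?V h x))\<^sup>2 * ?W x) \<partial>lebesgue) =
      ennreal (?C * (LINT t|lebesgue. (cmod (h t))\<^sup>2))" if "h \<in> L2" for h
  proof -
    have "(\<integral>\<^sup>+y. ennreal (2 * pi / (\<bar>b\<bar> * \<epsilon>) * exp (\<epsilon> * y) * (cmod (\<psi> y))\<^sup>2) \<partial>lebesgue) = ennreal ?C"
      unfolding mult.assoc integral_mult_right_zero[symmetric]
      using e \<open>\<epsilon> > 0\<close> by (intro nn_integral_eq_integral integrable_mult_right) auto
    then show ?thesis
      using nn_integral_ea_overlap[OF that \<psi> \<open>b \<noteq> 0\<close> \<open>\<epsilon> > 0\<close>, of a]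
      by (simp only: case_prod_beta' nn_integral_norm_squared_L2[OF that] ennreal_mult'[OF C]
          mult.commute[of "ennreal (LINT x|lebesgue. (cmod (h x))\<^sup>2)"])
  qed
  \<comment> \<open>The second factor of the integrand is the conjugate of the overlap of
    \<open>g\<close>, which is the form polarization expects.\<close>
  have eq: "ea_integrand \<epsilon> a b \<psi> f g = (\<lambda>x. ?V f x * cnj (?V g x) * complex_of_real (?W x))"
    by (auto simp: ea_integrand_def fun_eq_iff simp flip: inner_L2_commute)
  note * = resolution_of_identity_polarization[where V = ?V and W = ?W, OF V W W0 add norm C f g]
  show "integrable lebesgue (ea_integrand \<epsilon> a b \<psi> f g)"
    unfolding eq by (rule *(1))
  show "integral\<^sup>L lebesgue (ea_integrand \<epsilon> a b \<psi> f g) = complex_of_real ?C * inner_L2 f g"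
    unfolding eq by (rule *(2))
qed

lemma
  assumes \<psi>: "\<psi> \<in> L2" and "A \<noteq> 0" and f: "f \<in> L2" and g: "g \<in> L2"
  shows integrable_heis_integrand: "integrable lebesgue (heis_integrand A B \<psi> f g)"
    and integral_heis_integrand: "integral\<^sup>L lebesgue (heis_integrand A B \<psi> f g) =
      complex_of_real (2 * pi / \<bar>A\<bar> * (LINT y|lebesgue. (cmod (\<psi> y))\<^sup>2)) * inner_L2 f g"
proof -
  let ?C = "2 * pi / \<bar>A\<bar> * (LINT y|lebesgue. (cmod (\<psi> y))\<^sup>2)"
  let ?V = "\<lambda>f (q, p). inner_L2 f (heis_coherent A B \<psi> q p)"
  have C: "?C \<ge> 0"
    by (intro mult_nonneg_nonneg integral_nonneg_AE) auto
  have V: "?V h \<in> borel_measurable lebesgue" if "h \<in> L2" for h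
    using measurable_heis_overlap[OF that \<psi> \<open>A \<noteq> 0\<close>] .
  have coh: "heis_coherent A B \<psi> q p \<in> L2" for q p
  proof -
    have "heis_coherent A B \<psi> q p =
        (\<lambda>x. cis (A * (q * p / 2) + B * p + p * (A * x)) * \<psi> (x + q))"
      by (intro ext heis_coherent_phase)
    also have "\<dots> \<in> L2"
      by (intro L2_mult_cis L2_translate \<psi>) measurable
    finally show ?thesis .
  qed
  have add: "?V (\<lambda>t. h t + z * k t) x = ?V h x + cnj z * ?V k x" if "h \<in> L2" "k \<in> L2" for h k z x
    using inner_L2_conj_linear_left[OF that coh] by (auto split: prod.split)
  have norm: "(\<integral>\<^sup>+x. ennreal ((cmod (?V h x))\<^sup>2 * 1) \<partial>lebesgue) =
      ennreal (?C * (LINT t|lebesgue. (cmod (h t))\<^sup>2))" if "h \<in> L2" for h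
  proof -
    have "(\<integral>\<^sup>+y. ennreal (2 * pi / \<bar>A\<bar> * (cmod (\<psi> y))\<^sup>2) \<partial>lebesgue) = ennreal ?C"
      unfolding integral_mult_right_zero[symmetric]
      using \<psi> by (intro nn_integral_eq_integral integrable_mult_right) (auto simp: L2_def)
    then show ?thesis
      using nn_integral_heis_overlap[OF that \<psi> \<open>A \<noteq> 0\<close>, of B]
      by (simp only: case_prod_beta' nn_integral_norm_squared_L2[OF that] ennreal_mult'[OF C]
          mult.commute[of "ennreal (LINT x|lebesgue. (cmod (h x))\<^sup>2)"])
  qed
  have eq: "heis_integrand A B \<psi> f g = (\<lambda>x. ?V f x * cnj (?V g x) * complex_of_real 1)"
    by (auto simp: heis_integrand_def fun_eq_iff simp flip: inner_L2_commute)
  note * = resolution_of_identity_polarization[where V = ?V and W = "\<lambda>_. 1", OF V _ _ add norm C f g]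
  show "integrable lebesgue (heis_integrand A B \<psi> f g)"
    unfolding eq by (rule *(1)) auto
  show "integral\<^sup>L lebesgue (heis_integrand A B \<psi> f g) = complex_of_real ?C * inner_L2 f g"
    unfolding eq by (rule *(2)) auto
qed

section \<open>Exponential moments and the limit\<close>

text \<open>With \<open>f = \<psi>\<close> the overlap integral is the squared norm of
  \<open>\<psi>\<close> times its exponential moment; a finite product with nonzero first factor has
  a finite second factor.\<close>

lemma admissible_imp_integrable_exp:
  assumes \<psi>: "\<psi> \<in> L2" and nonzero: "\<not> (AE x in lebesgue. \<psi> x = 0)" and "b \<noteq> 0" and "\<epsilon> > 0"
    and "admissible \<epsilon> a b \<psi>"
  shows "integrable lebesgue (\<lambda>y. exp (\<epsilon> * y) * (cmod (\<psi> y))\<^sup>2)"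
proof -
  have [measurable]: "\<psi> \<in> borel_measurable lebesgue"
    using \<psi> by (simp add: L2_def)
  have [measurable]: "(\<lambda>y. exp (\<epsilon> * y)) \<in> borel_measurable lebesgue"
    by (rule measurable_completion) simp
  \<comment> \<open>Nonvanishing matters because \<open>0 * \<infinity> = 0\<close> for extended
    reals.\<close>
  have "(\<integral>\<^sup>+x. ennreal ((cmod (\<psi> x))\<^sup>2) \<partial>lebesgue) \<noteq> 0"
    using nonzero by (subst nn_integral_0_iff_AE) auto
  then have fin: "(\<integral>\<^sup>+y. ennreal (2 * pi / (\<bar>b\<bar> * \<epsilon>) * exp (\<epsilon> * y) * (cmod (\<psi> y))\<^sup>2) \<partial>lebesgue) < \<infinity>"
    using assms(5) nn_integral_ea_overlap[OF \<psi> \<psi> \<open>b \<noteq> 0\<close> \<open>\<epsilon> > 0\<close>, of a]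
    unfolding admissible_def by (auto simp: ennreal_mult_less_top)
  have "integrable lebesgue (\<lambda>y. 2 * pi / (\<bar>b\<bar> * \<epsilon>) * exp (\<epsilon> * y) * (cmod (\<psi> y))\<^sup>2)"
    using fin \<open>\<epsilon> > 0\<close> by (intro integrableI_bounded) (auto simp: abs_mult)
  from integrable_mult_right[OF this, of "\<bar>b\<bar> * \<epsilon> / (2 * pi)"] show ?thesis
    using \<open>b \<noteq> 0\<close> \<open>\<epsilon> > 0\<close> by simp
qed

text \<open>For \<open>\<epsilon>\<close> in \<open>[0, 1]\<close>,
  \<open>exp (\<epsilon> * y) \<le> 1 + exp y\<close>, so \<open>h y + exp y * h y\<close> is a
  majorant independent of \<open>\<epsilon>\<close>.\<close>

lemma
  fixes h :: "real \<Rightarrow> real"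
  assumes [measurable]: "h \<in> borel_measurable lebesgue" and h0: "\<And>y. h y \<ge> 0"
    and h: "integrable lebesgue h" and e: "integrable lebesgue (\<lambda>y. exp y * h y)"
  shows integrable_exp_interpolation:
      "\<And>\<epsilon>. \<epsilon> \<in> {0..1} \<Longrightarrow> integrable lebesgue (\<lambda>y. exp (\<epsilon> * y) * h y)"
    and tendsto_integral_exp:
      "((\<lambda>\<epsilon>. LINT y|lebesgue. exp (\<epsilon> * y) * h y) \<longlongrightarrow> integral\<^sup>L lebesgue h) (at_right 0)"
proof -
  have [measurable]: "(\<lambda>y. exp (\<epsilon> * y)) \<in> borel_measurable lebesgue" for \<epsilon> :: real
    by (rule measurable_completion) simp
  have dom: "integrable lebesgue (\<lambda>y. h y + exp y * h y)"
    using h e by simp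
  have bound: "norm (exp (\<epsilon> * y) * h y) \<le> h y + exp y * h y" if "\<epsilon> \<in> {0..1}" for \<epsilon> y
  proof -
    have "exp (\<epsilon> * y) \<le> 1 + exp y"
    proof (cases "y \<ge> 0")
      case True
      then have "\<epsilon> * y \<le> y"
        using that by (simp add: mult_left_le_one_le)
      then show ?thesis
        by (simp add: add_increasing)
    next
      case False
      then have "\<epsilon> * y \<le> 0"
        using that by (simp add: mult_nonneg_nonpos)
      then have "exp (\<epsilon> * y) \<le> 1"
        by simp
      then show ?thesis
        using exp_ge_zero[of y] by linarith
    qed
    from mult_right_mono[OF this h0[of y]] show ?thesis
      using h0[of y] by (simp add: distrib_right)
  qed
  show "integrable lebesgue (\<lambda>y. exp (\<epsilon> * y) * h y)" if "\<epsilon> \<in> {0..1}" for \<epsilon>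
    by (rule Bochner_Integration.integrable_bound[OF dom])
       (use order.trans[OF bound[OF that] abs_ge_self] in auto)
  show "((\<lambda>\<epsilon>. LINT y|lebesgue. exp (\<epsilon> * y) * h y) \<longlongrightarrow> integral\<^sup>L lebesgue h) (at_right 0)"
  \<comment> \<open>Sequences in \<open>(0, 1)\<close> suffice for the right-hand limit, and there
    the majorant applies.\<close>
  proof (rule tendsto_at_right_sequentially[of 0 1])
    fix S :: "nat \<Rightarrow> real"
    assume S: "\<And>n. 0 < S n" "\<And>n. S n < 1" "S \<longlonglongrightarrow> 0"
    have "(\<lambda>n. LINT y|lebesgue. exp (S n * y) * h y) \<longlonglongrightarrow> (LINT y|lebesgue. exp (0 * y) * h y)"
    proof (rule integral_dominated_convergence[OF _ _ dom])
      show "AE y in lebesgue. (\<lambda>n. exp (S n * y) * h y) \<longlonglongrightarrow> exp (0 * y) * h y"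
        by (intro AE_I2 tendsto_intros S)
      show "AE y in lebesgue. norm (exp (S n * y) * h y) \<le> h y + exp y * h y" for n
        using S(1,2)[of n] by (intro AE_I2 bound) auto
    qed measurable
    then show "(\<lambda>n. LINT y|lebesgue. exp (S n * y) * h y) \<longlonglongrightarrow> integral\<^sup>L lebesgue h"
      by simp
  qed simp
qed

text \<open>Integrability belongs to the conclusion because the integral of a nonintegrable function
  is 0 by convention, so the limit alone would say less.\<close>

theorem mainTheorem7:
  fixes A B a0 b0 :: real and a b :: "real \<Rightarrow> real" and \<psi> f g :: "real \<Rightarrow> complex"
  assumes "A \<noteq> 0" and "a0 + b0 = B"
    and "\<And>\<epsilon>. \<epsilon> \<in> {0<..1} \<Longrightarrow> a \<epsilon> = a0 + A / \<epsilon>"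
    and "\<And>\<epsilon>. \<epsilon> \<in> {0<..1} \<Longrightarrow> b \<epsilon> = b0 - A / \<epsilon>"
    and "\<And>\<epsilon>. \<epsilon> \<in> {0<..1} \<Longrightarrow> b \<epsilon> \<noteq> 0"
    and "\<psi> \<in> L2" and "\<not> (AE x in lebesgue. \<psi> x = 0)"
    and "\<And>\<epsilon>. \<epsilon> \<in> {0<..1} \<Longrightarrow> admissible \<epsilon> (a \<epsilon>) (b \<epsilon>) \<psi>"
    and "f \<in> L2" and "g \<in> L2"
  shows "(\<forall>\<epsilon>\<in>{0<..1}. integrable lebesgue (ea_integrand \<epsilon> (a \<epsilon>) (b \<epsilon>) \<psi> f g))
    \<and> integrable lebesgue (heis_integrand A B \<psi> f g)
    \<and> ((\<lambda>\<epsilon>. integral\<^sup>L lebesgue (ea_integrand \<epsilon> (a \<epsilon>) (b \<epsilon>) \<psi> f g))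
        \<longlongrightarrow> integral\<^sup>L lebesgue (heis_integrand A B \<psi> f g)) (at_right 0)"
proof (intro conjI ballI)
  let ?h = "\<lambda>y. (cmod (\<psi> y))\<^sup>2"
  let ?E = "\<lambda>\<epsilon>. LINT y|lebesgue. exp (\<epsilon> * y) * ?h y"
  have h: "?h \<in> borel_measurable lebesgue" "integrable lebesgue ?h"
    using \<open>\<psi> \<in> L2\<close> by (auto simp: L2_def)
  \<comment> \<open>Admissibility at \<open>\<epsilon> = 1\<close> controls the top exponential
    moment; interpolation with the squared norm gives the moments below it.\<close>
  have "integrable lebesgue (\<lambda>y. exp y * ?h y)"
    using admissible_imp_integrable_exp[OF assms(6,7) assms(5)[of 1] _ assms(8)[of 1]] by simp
  note exp = integrable_exp_interpolation[OF h(1) _ h(2) this] tendsto_integral_exp[OF h(1) _ h(2) this]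
  have e: "integrable lebesgue (\<lambda>y. exp (\<epsilon> * y) * ?h y)" if "\<epsilon> \<in> {0<..1}" for \<epsilon>
    by (rule exp(1)) (use that in auto)
  show "integrable lebesgue (ea_integrand \<epsilon> (a \<epsilon>) (b \<epsilon>) \<psi> f g)" if "\<epsilon> \<in> {0<..1}" for \<epsilon>
    by (rule integrable_ea_integrand) (use assms(5,6,9,10) e that in auto)
  show "integrable lebesgue (heis_integrand A B \<psi> f g)"
    by (rule integrable_heis_integrand) (use assms in auto)
  have ev: "\<forall>\<^sub>F \<epsilon> in at_right 0. \<epsilon> \<in> {0<..1::real}"
    by (rule eventually_at_rightI[of 0 1]) auto
  \<comment> \<open>\<open>b \<epsilon>\<close> grows without bound, but \<open>\<bar>b
    \<epsilon>\<bar> * \<epsilon> = \<bar>b0 * \<epsilon> - A\<bar>\<close> is continuous at 0 with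
    nonzero limit \<open>\<bar>A\<bar>\<close>.\<close>
  have "((\<lambda>\<epsilon>. \<bar>b0 * \<epsilon> - A\<bar>) \<longlongrightarrow> \<bar>b0 * 0 - A\<bar>) (at_right 0)"
    by (intro tendsto_intros)
  moreover have "((\<lambda>\<epsilon>. ?E \<epsilon>) \<longlongrightarrow> integral\<^sup>L lebesgue ?h) (at_right 0)"
    by (rule exp(2)) simp
  ultimately have "((\<lambda>\<epsilon>. complex_of_real (2 * pi / \<bar>b0 * \<epsilon> - A\<bar> * ?E \<epsilon>) * inner_L2 f g) \<longlongrightarrow>
      complex_of_real (2 * pi / \<bar>b0 * 0 - A\<bar> * integral\<^sup>L lebesgue ?h) * inner_L2 f g) (at_right 0)"
    using \<open>A \<noteq> 0\<close> by (intro tendsto_mult tendsto_of_real tendsto_divide tendsto_const) auto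
  moreover have "\<forall>\<^sub>F \<epsilon> in at_right 0. complex_of_real (2 * pi / \<bar>b0 * \<epsilon> - A\<bar> * ?E \<epsilon>) * inner_L2 f g =
      integral\<^sup>L lebesgue (ea_integrand \<epsilon> (a \<epsilon>) (b \<epsilon>) \<psi> f g)"
    using ev
  proof eventually_elim
    case (elim \<epsilon>)
    then have "\<bar>b \<epsilon>\<bar> * \<epsilon> = \<bar>b \<epsilon> * \<epsilon>\<bar>"
      by (simp add: abs_mult)
    also have "b \<epsilon> * \<epsilon> = b0 * \<epsilon> - A"
      using elim assms(4)[OF elim] by (simp add: left_diff_distrib)
    finally have "\<bar>b \<epsilon>\<bar> * \<epsilon> = \<bar>b0 * \<epsilon> - A\<bar>" .
    then show ?case
      using integral_ea_integrand[OF assms(6) assms(5)[OF elim] _ assms(9,10) e[OF elim], of "a \<epsilon>"] elim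
      by simp
  qed
  ultimately show "((\<lambda>\<epsilon>. integral\<^sup>L lebesgue (ea_integrand \<epsilon> (a \<epsilon>) (b \<epsilon>) \<psi> f g)) \<longlongrightarrow>
      integral\<^sup>L lebesgue (heis_integrand A B \<psi> f g)) (at_right 0)"
    unfolding integral_heis_integrand[OF assms(6,1,9,10)]
    by (auto elim: Lim_transform_eventually)
qed

end
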